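(* Let $X$ be the space of Whitney umbrellas up to four-jets, identified with a subset of a Euclidean space. For a Whitney umbrella $f$, let $h=h_{\kappa_1}:(\mathcal{M}_0,\mathcal{E}_0)\to\mathbb{R}^3$ be its principal curvature surface with respect to the bounded principal curvature $\kappa_1$. (1) There exists an algebraic subset $A_g\subsetneq X$ such that for any $f\in X\setminus A_g$, the curve $h|_{\mathcal{E}_0}$ has no singular point, and the number of zeros of the geodesic curvature $\kappa_g$ of $h|_{\mathcal{E}_0}$ as a curve on $h$ is $2n-1$ for some $n\in\{1,\ldots,5\}$. (2) There exists an algebraic subset $A_n\subsetneq X$ such that for any $f\in X\setminus A_n$, the curve $h|_{\mathcal{E}_0}$ has no singular point, and the number of zeros of the normal curvature $\kappa_n$ of $h|_{\mathcal{E}_0}$ as a curve on $h$ is $2n-1$ for some $n\in\{1,\ldots,4\}$.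
   Context: All maps and germs are $C^\infty$. A map-germ $f:(\mathbb{R}^2,0)\to(\mathbb{R}^3,0)$ is a Whitney umbrella if there are diffeomorphism-germs $\lambda$ of $(\mathbb{R}^2,0)$ and $\mu$ of $(\mathbb{R}^3,0)$ with $\mu\circ f\circ\lambda^{-1}(u,v)=(u,v^2,uv)$. Normal form: by an orientation preserving diffeomorphism-germ of the source and an element of $SO(3)$ in the target, a Whitney umbrella can be brought to the form $$f(u,v)=\big(u,\;u^2f_{21}(u)+v^2,\;u^2f_{31}(u)+v^2(uf_{321}(u)+vf_{322}(u,v))+uvf_{331}(u)\big),\qquad f_{331}(0)>0,$$ where $f_{21},f_{31},f_{321},f_{331}$ are function-germs of one variable and $f_{322}$ of two variables, and these functions are uniquely determined by $f$. Space $X$: $X$ is the set of tuples $(j^2f_{21}(0),j^2f_{31}(0),j^1f_{321}(0),j^1f_{322}(0,0),j^2f_{331}(0))$ with $f_{331}(0)>0$ (jets include the constant term), regarded as a subset of a Euclidean space via Taylor coefficients; it parametrizes four-jets of Whitney umbrellas up to source diffeomorphisms and $SO(3)$. An algebraic subset of $X$ is the zero set in $X$ of polynomials in these coordinates. Writing $f\in X\setminus A$ means that $f$ is a Whitney umbrella, written in normal form, whose tuple of jets lies in $X\setminus A$. Blow-up: $\mathcal{M}$ is the quotient of $\mathbb{R}\times(\mathbb{R}/2\pi\mathbb{Z})$ by $(r,\theta)\sim(-r,\theta+\pi)$, with $\pi:\mathcal{M}\to\mathbb{R}^2$, $\pi(r,\theta)=(r\cos\theta,r\sin\theta)$. One identifies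 $f$ with $f\circ\pi$. $\mathcal{E}=\{(0,\theta)\in\mathcal{M}\}$, $\mathcal{E}_0=\{(0,\theta)\in\mathcal{E}:\cos\theta\neq0\}$, and $\mathcal{M}_0\subset\mathcal{M}$ is the open set of points $(r,\theta)$ such that, if $r=0$, then $(\cos\theta,\sin\theta)\notin\ker df_0$. Maps $(\mathcal{M}_0,\mathcal{E}_0)\to\cdot$ are germs along $\mathcal{E}_0$. Principal curvature surface: the unit normal $\nu$ of $f$ extends smoothly, up to sign, across $\mathcal{E}$. The principal curvatures are the roots $k$ of $\det(\mathrm{II}-k\,\mathrm{I})=0$, where $\mathrm{I},\mathrm{II}$ are the matrices of the first and second fundamental forms of $f$ in the coordinates $(u,v)$ (second with respect to $\nu$). Exactly one of them is bounded near $\mathcal{E}_0$ and it extends smoothly there; it is denoted $\kappa_1$, and $h_{\kappa_1}=f+\kappa_1\nu$. Curvatures: for the curve $\hat e(\theta)=h(0,\theta)$ and a unit normal vector $n$ of the surface $h$ along it, $\kappa_g=\det(\hat e',\hat e'',n)/|\hat e'|^3$ and $\kappa_n=(\hat e''\cdot n)/|\hat e'|^2$, defined on $\mathcal{E}_0\setminus S(h|_{\mathcal{E}_0})$, where $S(\cdot)$ denotes the set of singular points. Zeros are counted as points of $\mathcal{E}_0$ (equivalently as values of $t=\tan\theta\in\mathbb{R}$). *)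

theory Defs
  imports "HOL-Analysis.Analysis"
begin

text \<open>Only used for open \<open>S\<close>.\<close>

primrec Ck_on :: "nat \<Rightarrow> 'a::euclidean_space set \<Rightarrow> ('a \<Rightarrow> 'b::euclidean_space) \<Rightarrow> bool" where
  "Ck_on 0 S f = continuous_on S f"
| "Ck_on (Suc k) S f = ((\<forall>x\<in>S. f differentiable (at x)) \<and>
      (\<forall>v. Ck_on k S (\<lambda>x. frechet_derivative f (at x) v)))"

definition smooth_on :: "'a::euclidean_space set \<Rightarrow> ('a \<Rightarrow> 'b::euclidean_space) \<Rightarrow> bool" where
  "smooth_on S f \<longleftrightarrow> (\<forall>k. Ck_on k S f)"

text \<open>Germs at \<open>0\<close> are represented by total functions, of which only the
  restriction to a small neighbourhood of \<open>0\<close> matters.\<close>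

definition smooth_germ :: "('a::euclidean_space \<Rightarrow> 'b::euclidean_space) \<Rightarrow> bool" where
  "smooth_germ f \<longleftrightarrow> (\<exists>U. open U \<and> 0 \<in> U \<and> smooth_on U f)"

text \<open>\<open>\<psi>\<close> represents the inverse germ of \<open>\<phi>\<close>.\<close>

definition diffeo_germ :: "('a::euclidean_space \<Rightarrow> 'a) \<Rightarrow> ('a \<Rightarrow> 'a) \<Rightarrow> bool" where
  "diffeo_germ \<phi> \<psi> \<longleftrightarrow> (\<exists>U V. open U \<and> open V \<and> 0 \<in> U \<and> 0 \<in> V \<and> \<phi> 0 = 0 \<and>
      homeomorphism U V \<phi> \<psi> \<and> smooth_on U \<phi> \<and> smooth_on V \<psi>)"

definition whitney_umbrella :: "(real \<times> real \<Rightarrow> real^3) \<Rightarrow> bool" where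
  "whitney_umbrella f \<longleftrightarrow> smooth_germ f \<and> f 0 = 0 \<and>
     (\<exists>\<phi> \<phi>inv \<mu> \<mu>inv. diffeo_germ \<phi> \<phi>inv \<and> diffeo_germ \<mu> \<mu>inv \<and>
        (\<forall>\<^sub>F (u, v) in nhds 0. \<mu> (f (\<phi>inv (u, v))) = vector [u, v\<^sup>2, u * v]))"

definition normal_form ::
  "(real \<times> real \<Rightarrow> real^3) \<Rightarrow> (real \<Rightarrow> real) \<Rightarrow> (real \<Rightarrow> real) \<Rightarrow> (real \<Rightarrow> real) \<Rightarrow>
   (real \<times> real \<Rightarrow> real) \<Rightarrow> (real \<Rightarrow> real) \<Rightarrow> bool" where
  "normal_form f f21 f31 f321 f322 f331 \<longleftrightarrow>
     smooth_germ f21 \<and> smooth_germ f31 \<and> smooth_germ f321 \<and> smooth_germ f322 \<and>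
     smooth_germ f331 \<and> f331 0 > 0 \<and>
     (\<forall>\<^sub>F (u, v) in nhds 0. f (u, v) = vector
        [u,
         u\<^sup>2 * f21 u + v\<^sup>2,
         u\<^sup>2 * f31 u + v\<^sup>2 * (u * f321 u + v * f322 (u, v)) + u * v * f331 u])"

abbreviation pdu :: "(real \<times> real \<Rightarrow> 'b::real_normed_vector) \<Rightarrow> real \<times> real \<Rightarrow> 'b" where
  "pdu f p \<equiv> frechet_derivative f (at p) (1, 0)"

abbreviation pdv :: "(real \<times> real \<Rightarrow> 'b::real_normed_vector) \<Rightarrow> real \<times> real \<Rightarrow> 'b" where
  "pdv f p \<equiv> frechet_derivative f (at p) (0, 1)"

text \<open>Jets at the origin, as vectors of Taylor coefficients.\<close>

definition jet1 :: "(real \<Rightarrow> real) \<Rightarrow> real^2" where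
  "jet1 g = vector [g 0, deriv g 0]"

definition jet2 :: "(real \<Rightarrow> real) \<Rightarrow> real^3" where
  "jet2 g = vector [g 0, deriv g 0, deriv (deriv g) 0 / 2]"

definition jet1_two_var :: "(real \<times> real \<Rightarrow> real) \<Rightarrow> real^3" where
  "jet1_two_var g = vector [g 0, pdu g 0, pdv g 0]"

text \<open>The components are the jets of \<open>f21, f31, f321, f322, f331\<close>, in this order.\<close>

type_synonym jet_space = "(real^3) \<times> (real^3) \<times> (real^2) \<times> (real^3) \<times> (real^3)"

definition umbrella_jets :: "jet_space set" where
  "umbrella_jets = {(j21, j31, j321, j322, j331). j331 $ 1 > 0}"

definition algebraic_subset :: "jet_space set \<Rightarrow> bool" where
  "algebraic_subset A \<longleftrightarrow>
     (\<exists>P. finite P \<and> (\<forall>p\<in>P. real_polynomial_function p) \<and>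
          A = {x \<in> umbrella_jets. \<forall>p\<in>P. p x = 0})"

definition umbrella_in :: "(real \<times> real \<Rightarrow> real^3) \<Rightarrow> jet_space set \<Rightarrow> bool" where
  "umbrella_in f B \<longleftrightarrow> whitney_umbrella f \<and>
     (\<exists>f21 f31 f321 f322 f331. normal_form f f21 f31 f321 f322 f331 \<and>
        (jet2 f21, jet2 f31, jet1 f321, jet1_two_var f322, jet2 f331) \<in> B)"

text \<open>The relation on \<open>\<real> \<times> \<real>\<close> generated by \<open>(r, \<theta>) \<sim> (-r, \<theta> + \<pi>)\<close>; it contains
  \<open>(r, \<theta>) \<sim> (r, \<theta> + 2\<pi>)\<close>.\<close>

definition blowup_rel :: "real \<times> real \<Rightarrow> real \<times> real \<Rightarrow> bool" where
  "blowup_rel p q \<longleftrightarrow>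
     (\<exists>k::int. fst q = (if even k then fst p else - fst p) \<and> snd q = snd p + of_int k * pi)"

quotient_type blowup = "real \<times> real" / blowup_rel
proof (rule equivpI)
  show "reflp blowup_rel"
    unfolding reflp_def blowup_rel_def by (auto intro: exI[of _ 0])
  show "symp blowup_rel"
    unfolding symp_def blowup_rel_def
  proof (intro allI impI)
    fix p q :: "real \<times> real"
    assume "\<exists>k::int. fst q = (if even k then fst p else - fst p) \<and> snd q = snd p + of_int k * pi"
    then obtain k :: int where "fst q = (if even k then fst p else - fst p)"
      "snd q = snd p + of_int k * pi" by blast
    then show "\<exists>k::int. fst p = (if even k then fst q else - fst q) \<and> snd p = snd q + of_int k * pi"
      by (intro exI[of _ "- k"]) auto
  qed
  show "transp blowup_rel"
    unfolding transp_def blowup_rel_def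
  proof (intro allI impI)
    fix p q s :: "real \<times> real"
    assume "\<exists>k::int. fst q = (if even k then fst p else - fst p) \<and> snd q = snd p + of_int k * pi"
      "\<exists>k::int. fst s = (if even k then fst q else - fst q) \<and> snd s = snd q + of_int k * pi"
    then obtain k l :: int where "fst q = (if even k then fst p else - fst p)"
      "snd q = snd p + of_int k * pi"
      "fst s = (if even l then fst q else - fst q)" "snd s = snd q + of_int l * pi" by blast
    then show "\<exists>k::int. fst s = (if even k then fst p else - fst p) \<and> snd s = snd p + of_int k * pi"
      by (intro exI[of _ "k + l"]) (auto simp: algebra_simps)
  qed
qed

definition blow_down :: "real \<times> real \<Rightarrow> real \<times> real" where
  "blow_down = (\<lambda>(r, \<theta>). (r * cos \<theta>, r * sin \<theta>))"

definition blowup_M0 :: "(real \<times> real \<Rightarrow> real^3) \<Rightarrow> blowup set" where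
  "blowup_M0 f = {abs_blowup (r, \<theta>) | r \<theta>.
     r = 0 \<longrightarrow> frechet_derivative f (at 0) (cos \<theta>, sin \<theta>) \<noteq> 0}"

definition blowup_E0 :: "blowup set" where
  "blowup_E0 = {abs_blowup (0, \<theta>) | \<theta>. cos \<theta> \<noteq> 0}"

definition first_form :: "(real \<times> real \<Rightarrow> real^3) \<Rightarrow> real \<times> real \<Rightarrow> real^2^2" where
  "first_form f p = vector
     [vector [pdu f p \<bullet> pdu f p, pdu f p \<bullet> pdv f p],
      vector [pdu f p \<bullet> pdv f p, pdv f p \<bullet> pdv f p]]"

definition second_form :: "(real \<times> real \<Rightarrow> real^3) \<Rightarrow> real \<times> real \<Rightarrow> real^3 \<Rightarrow> real^2^2" where
  "second_form f p \<nu> = vector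
     [vector [pdu (pdu f) p \<bullet> \<nu>, pdv (pdu f) p \<bullet> \<nu>],
      vector [pdv (pdu f) p \<bullet> \<nu>, pdv (pdv f) p \<bullet> \<nu>]]"

definition unit_normal_at :: "(real \<times> real \<Rightarrow> real^3) \<Rightarrow> real \<times> real \<Rightarrow> real^3 \<Rightarrow> bool" where
  "unit_normal_at f p \<nu> \<longleftrightarrow> norm \<nu> = 1 \<and> (\<forall>w. frechet_derivative f (at p) w \<bullet> \<nu> = 0)"

definition principal_curvature_at ::
  "(real \<times> real \<Rightarrow> real^3) \<Rightarrow> real \<times> real \<Rightarrow> real^3 \<Rightarrow> real \<Rightarrow> bool" where
  "principal_curvature_at f p \<nu> k \<longleftrightarrow> det (second_form f p \<nu> - k *\<^sub>R first_form f p) = 0"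

text \<open>\<open>h\<close> represents the germ along \<open>\<E>\<^sub>0\<close> of \<open>f + \<kappa>\<^sub>1 \<nu>\<close>. The unit normal \<open>\<nu>\<close> and
  \<open>\<kappa>\<^sub>1\<close> live on an open set \<open>U\<close> of the cover \<open>\<real> \<times> \<real>\<close>, since they are defined on the
  blow-up only up to a common sign; their product descends. A principal curvature that
  extends smoothly across the lift of \<open>\<E>\<^sub>0\<close> is bounded near it, so \<open>\<kappa>\<close> is the bounded one.\<close>

definition principal_curvature_surface ::
  "(real \<times> real \<Rightarrow> real^3) \<Rightarrow> (blowup \<Rightarrow> real^3) \<Rightarrow> bool" where
  "principal_curvature_surface f h \<longleftrightarrow>
     (\<exists>U \<nu> \<kappa>. open U \<and> abs_blowup -` blowup_E0 \<subseteq> U \<and> U \<subseteq> abs_blowup -` blowup_M0 f \<and>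
        smooth_on U \<nu> \<and> smooth_on U \<kappa> \<and>
        (\<forall>p\<in>U. fst p \<noteq> 0 \<longrightarrow> unit_normal_at f (blow_down p) (\<nu> p) \<and>
                 principal_curvature_at f (blow_down p) (\<nu> p) (\<kappa> p)) \<and>
        (\<forall>p\<in>U. h (abs_blowup p) = f (blow_down p) + \<kappa> p *\<^sub>R \<nu> p))"

definition exceptional_curve :: "(blowup \<Rightarrow> real^3) \<Rightarrow> real \<Rightarrow> real^3" where
  "exceptional_curve h \<theta> = h (abs_blowup (0, \<theta>))"

definition curve_singular_set :: "(blowup \<Rightarrow> real^3) \<Rightarrow> blowup set" where
  "curve_singular_set h = {abs_blowup (0, \<theta>) | \<theta>. cos \<theta> \<noteq> 0 \<and>
     vector_derivative (exceptional_curve h) (at \<theta>) = 0}"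

text \<open>A unit normal of the surface \<open>h\<close> at each point of \<open>\<E>\<^sub>0\<close>. It is unique up to sign
  wherever \<open>h\<close> is an immersion, and the zeros of the curvatures below do not depend on
  the sign.\<close>

definition unit_normal_along_E0 :: "(blowup \<Rightarrow> real^3) \<Rightarrow> (blowup \<Rightarrow> real^3) \<Rightarrow> bool" where
  "unit_normal_along_E0 h n \<longleftrightarrow> (\<forall>\<theta>. cos \<theta> \<noteq> 0 \<longrightarrow>
     unit_normal_at (\<lambda>p. h (abs_blowup p)) (0, \<theta>) (n (abs_blowup (0, \<theta>))))"

definition geodesic_curvature :: "(real \<Rightarrow> real^3) \<Rightarrow> real^3 \<Rightarrow> real \<Rightarrow> real" where
  "geodesic_curvature e n \<theta> =
     det (vector [vector_derivative e (at \<theta>),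
                  vector_derivative (\<lambda>s. vector_derivative e (at s)) (at \<theta>), n] :: real^3^3)
       / norm (vector_derivative e (at \<theta>)) ^ 3"

definition normal_curvature :: "(real \<Rightarrow> real^3) \<Rightarrow> real^3 \<Rightarrow> real \<Rightarrow> real" where
  "normal_curvature e n \<theta> =
     (vector_derivative (\<lambda>s. vector_derivative e (at s)) (at \<theta>) \<bullet> n)
       / norm (vector_derivative e (at \<theta>)) ^ 2"

definition geodesic_zeros :: "(blowup \<Rightarrow> real^3) \<Rightarrow> (blowup \<Rightarrow> real^3) \<Rightarrow> blowup set" where
  "geodesic_zeros h n = {abs_blowup (0, \<theta>) | \<theta>. cos \<theta> \<noteq> 0 \<and>
     geodesic_curvature (exceptional_curve h) (n (abs_blowup (0, \<theta>))) \<theta> = 0}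
     - curve_singular_set h"

definition normal_zeros :: "(blowup \<Rightarrow> real^3) \<Rightarrow> (blowup \<Rightarrow> real^3) \<Rightarrow> blowup set" where
  "normal_zeros h n = {abs_blowup (0, \<theta>) | \<theta>. cos \<theta> \<noteq> 0 \<and>
     normal_curvature (exceptional_curve h) (n (abs_blowup (0, \<theta>))) \<theta> = 0}
     - curve_singular_set h"

end

theory Submission
  imports Defs "HOL-Computational_Algebra.Field_as_Ring" "Subresultants.Subresultant_Gcd"
begin

text \<open>Along a ray \<open>r \<mapsto> (r, \<theta>)\<close> of the blow-up, the equations for the unit normal and the bounded
  principal curvature (with \<open>f\<^sub>v\<close> divided by \<open>r\<close>) hold for \<open>r \<noteq> 0\<close>, hence they and their first
  derivatives hold at \<open>r = 0\<close>. This determines the curve \<open>h(0, \<theta>)\<close>, which lies in the plane orthogonal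
  to the first axis, and \<open>\<partial>h/\<partial>r\<close> along it. The zeros of \<open>\<kappa>\<^sub>g\<close> are the inflections of this planar curve
  and the points where the normal is orthogonal to the first axis; the zeros of \<open>\<kappa>\<^sub>n\<close> are the inflections and
  the points where the normal is parallel to that axis. In \<open>t = tan \<theta>\<close> these conditions are polynomial
  equations, of degree 9 and 7 in total, and a real polynomial of odd degree with simple
  roots has an odd number of real roots. Simplicity of the roots fails only on the zero set of a
  discriminant, which is proper because it misses one explicit jet.\<close>

text \<open>The factor \<open>Q\<close> comes from the curvature parabola. With a =
  \<open>f331 0\<close>, b = \<open>f21 0\<close> and c = \<open>f31 0\<close>, the vector f_uu + 2
  t f_uv + t^2 f_vv at the origin has coordinates (2 b + 2 t^2, 2 c + 2 a t) in the normal plane.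
  The tangent line of this parabola at t is - a X + 2 t Y = 2 Q, and h(0, \<theta>) is the foot of
  the perpendicular from the origin to it: the exceptional curve is the pedal curve of the parabola.
  The bounded curvature is singled out by the degeneration of the first fundamental form: at r = 0
  the quadratic equation for k becomes linear, and its derivative is linear in k'. One discriminant
  serves both claims. If the product of the four factors is square-free, then each factor has simple
  roots, the curve is regular (the inflection factor and \<open>Q\<close> have no common root), and
  the normal is determined well enough to read off its zeros (no common root of \<open>Q\<close>
  times the transversality factor and the unit curvature factor). For the discriminant to be
  polynomial in the jet its Sylvester matrix must have fixed size, so jets with a drop in degree are
  excluded too.\<close>

no_notation Matrix.vec_index (infixl "$" 100)

section \<open>Counting real roots\<close>

lemma odd_degree_imp_real_root:
  fixes p :: "real poly"
  assumes "odd (degree p)"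
  shows "\<exists>x. poly p x = 0"
proof -
  have root: "\<exists>x. poly q x = 0" if odd: "odd (degree q)" and lc: "lead_coeff q > 0" for q :: "real poly"
  proof -
    \<comment> \<open>For odd degree, \<open>- q (- X)\<close> has the same leading coefficient as
      \<open>q\<close>; its growth at plus infinity makes \<open>q\<close> negative far to the
      left.\<close>
    define q' where "q' = - pcompose q [:0, -1:]"
    have "lead_coeff q' = lead_coeff q"
      using odd lead_coeff_comp[of "[:0, -1:]" q]
      by (simp add: q'_def lead_coeff_minus del: degree_pcompose)
    then obtain m n where m: "\<And>x. x \<ge> m \<Longrightarrow> poly q x \<ge> lead_coeff q"
      and n: "\<And>x. x \<ge> n \<Longrightarrow> poly q' x \<ge> lead_coeff q"
      using poly_pinfty_gt_lc[of q] poly_pinfty_gt_lc[of q'] lc by metis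
    define k where "k = \<bar>m\<bar> + \<bar>n\<bar> + 1"
    have k: "k \<ge> m" "k \<ge> n" "k > 0" by (simp_all add: k_def)
    have "poly q k > 0" using m[OF k(1)] lc by simp
    moreover have "poly q (-k) < 0" using n[OF k(2)] lc by (simp add: q'_def poly_pcompose)
    ultimately show ?thesis
      using poly_IVT_pos[of "-k" k q] k(3) by auto
  qed
  have "lead_coeff p \<noteq> 0" using assms by auto
  then consider "lead_coeff p > 0" | "lead_coeff (- p) > 0" by (cases rule: linorder_cases[of "lead_coeff p" 0]) auto
  then show ?thesis
    using root[of p] root[of "- p"] assms by cases auto
qed

text \<open>Splitting off a simple root lowers both the degree and the number of roots by one, since
  the root is not a root of the quotient. Without real roots the degree is even by the intermediate
  value theorem.\<close>

lemma even_card_real_roots_iff: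
  fixes p :: "real poly"
  assumes "p \<noteq> 0" "\<And>x. poly p x = 0 \<Longrightarrow> poly (pderiv p) x \<noteq> 0"
  shows "even (card {x. poly p x = 0}) \<longleftrightarrow> even (degree p)"
  using assms
proof (induction "degree p" arbitrary: p rule: less_induct)
  case less
  show ?case
  proof (cases "\<exists>r. poly p r = 0")
    case False
    have "even (degree p)"
    proof (rule ccontr)
      assume "odd (degree p)"
      then show False using False odd_degree_imp_real_root by blast
    qed
    then show ?thesis using False by simp
  next
    case True
    then obtain r q where r: "poly p r = 0" and p: "p = [:-r, 1:] * q"
      by (auto simp: poly_eq_0_iff_dvd dvd_def)
    have q0: "q \<noteq> 0" using less.prems(1) p by auto
    have deg: "degree p = Suc (degree q)"
      using q0 unfolding p by (subst degree_mult_eq) auto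
    have pd: "poly (pderiv p) x = poly q x + (x - r) * poly (pderiv q) x" for x
      unfolding p by (simp only: pderiv_mult) (simp add: pderiv_pCons algebra_simps)
    have qr: "poly q r \<noteq> 0" using less.prems(2)[OF r] by (simp add: pd)
    have IH: "even (card {x. poly q x = 0}) \<longleftrightarrow> even (degree q)"
    proof (rule less.hyps)
      show "degree q < degree p" using deg by simp
      fix x assume x: "poly q x = 0"
      then have "poly p x = 0" by (simp add: p)
      then show "poly (pderiv q) x \<noteq> 0" using less.prems(2)[of x] x by (auto simp: pd)
    qed fact
    have "{x. poly p x = 0} = insert r {x. poly q x = 0}"
      by (auto simp: p)
    then have "card {x. poly p x = 0} = Suc (card {x. poly q x = 0})"
      using qr poly_roots_finite[OF q0] by simp
    then show ?thesis using IH deg by simp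
  qed
qed

lemma coprime_no_common_root:
  fixes p q :: "real poly"
  assumes "coprime p q"
  shows "\<not> (poly p t = 0 \<and> poly q t = 0)"
proof
  assume "poly p t = 0 \<and> poly q t = 0"
  then have "[:- t, 1:] dvd p" "[:- t, 1:] dvd q"
    by (simp_all only: poly_eq_0_iff_dvd)
  then have "is_unit [:- t, 1:]" by (rule coprime_common_divisor[OF assms])
  then show False using is_unit_iff_degree[of "[:- t, 1:]"] by simp
qed

lemma odd_card_real_roots:
  fixes p :: "real poly"
  assumes "odd (degree p)" "coprime p (pderiv p)"
  shows "odd (card {x. poly p x = 0})" "card {x. poly p x = 0} \<le> degree p"
proof -
  have p0: "p \<noteq> 0" using assms(1) by auto
  have "poly (pderiv p) x \<noteq> 0" if "poly p x = 0" for x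
    using coprime_no_common_root[OF assms(2), of x] that by simp
  then show "odd (card {x. poly p x = 0})"
    using even_card_real_roots_iff[OF p0] assms(1) by simp
  show "card {x. poly p x = 0} \<le> degree p"
    using card_poly_roots_bound[OF p0] .
qed

text \<open>A common divisor of \<open>p\<close> and \<open>pderiv p\<close>, or of \<open>p\<close>
  and \<open>q\<close>, divides both summands of the product rule. Thus one square-freeness
  condition on a product yields simple roots of its factors and the absence of common roots.\<close>

lemma coprime_pderiv_factor:
  fixes p q :: "real poly"
  assumes "coprime (p * q) (pderiv (p * q))"
  shows "coprime p (pderiv p)" "coprime p q"
proof -
  show "coprime p (pderiv p)"
  proof (rule coprimeI)
    fix c assume "c dvd p" "c dvd pderiv p"
    then have "c dvd p * q" "c dvd pderiv (p * q)" by (auto simp: pderiv_mult)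
    then show "is_unit c" using assms coprime_common_divisor by blast
  qed
  show "coprime p q"
  proof (rule coprimeI)
    fix c assume "c dvd p" "c dvd q"
    then have "c dvd p * q" "c dvd pderiv (p * q)" by (auto simp: pderiv_mult)
    then show "is_unit c" using assms coprime_common_divisor by blast
  qed
qed

text \<open>The converse direction, which reduces square-freeness of the product of degree 13 at the
  sample jet to small certificates for the factors and their pairs.\<close>

lemma coprime_pderiv_mult:
  fixes p q :: "real poly"
  assumes "coprime p (pderiv p)" "coprime q (pderiv q)" "coprime p q"
  shows "coprime (p * q) (pderiv (p * q))"
proof -
  have sum: "coprime a (a * u + v)" if "coprime a v" for a u v :: "real poly"
  proof (rule coprimeI)
    fix c assume "c dvd a" "c dvd a * u + v"
    moreover from \<open>c dvd a\<close> have "c dvd a * u" by simp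
    ultimately have "c dvd v" by (simp add: dvd_add_right_iff)
    with \<open>c dvd a\<close> that show "is_unit c" using coprime_common_divisor by blast
  qed
  have "coprime p (p * pderiv q + q * pderiv p)" "coprime q (q * pderiv p + p * pderiv q)"
    using assms by (auto intro!: sum simp: coprime_mult_right_iff coprime_commute)
  then show ?thesis by (simp add: pderiv_mult add.commute)
qed

lemma coprime_by_bezout:
  fixes p q :: "real poly"
  assumes "a * p + b * q = [:c:]" "c \<noteq> 0"
  shows "coprime p q"
proof (rule coprimeI)
  fix d assume "d dvd p" "d dvd q"
  then have "d dvd [:c:]" unfolding assms(1)[symmetric] by (intro dvd_add dvd_mult)
  moreover have "is_unit [:c:]" using assms(2) by (rule is_unit_triv)
  ultimately show "is_unit d" using dvd_trans by blast
qed

section \<open>Polynomials depending polynomially on a parameter\<close>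

definition polynomial_family :: "('a::real_normed_vector \<Rightarrow> real poly) \<Rightarrow> bool" where
  "polynomial_family F \<longleftrightarrow> (\<forall>i. real_polynomial_function (\<lambda>x. coeff (F x) i))"

lemma polynomial_family_const: "polynomial_family (\<lambda>x. p)"
  by (auto simp: polynomial_family_def)

lemma polynomial_family_pCons:
  "real_polynomial_function a \<Longrightarrow> polynomial_family F \<Longrightarrow> polynomial_family (\<lambda>x. pCons (a x) (F x))"
  unfolding polynomial_family_def by (intro allI, rename_tac i, case_tac i) auto

lemma polynomial_family_diff: "polynomial_family F \<Longrightarrow> polynomial_family G \<Longrightarrow> polynomial_family (\<lambda>x. F x - G x)"
  by (auto simp: polynomial_family_def)

lemma polynomial_family_smult: "polynomial_family F \<Longrightarrow> polynomial_family (\<lambda>x. Polynomial.smult c (F x))"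
  by (auto simp: polynomial_family_def)

lemma polynomial_family_mult: "polynomial_family F \<Longrightarrow> polynomial_family G \<Longrightarrow> polynomial_family (\<lambda>x. F x * G x)"
  by (auto simp: polynomial_family_def coeff_mult
      intro!: real_polynomial_function_sum real_polynomial_function.intros(4))

lemma polynomial_family_pderiv: "polynomial_family F \<Longrightarrow> polynomial_family (\<lambda>x. pderiv (F x))"
  by (auto simp: polynomial_family_def coeff_pderiv)

lemma real_polynomial_function_If:
  assumes "real_polynomial_function f" "real_polynomial_function g"
  shows "real_polynomial_function (\<lambda>x. if c then f x else g x)"
  using assms by (cases c) simp_all

text \<open>The sizes \<open>m\<close> and \<open>n\<close> are fixed because the Sylvester matrix
  for the actual degrees changes its size with \<open>x\<close>. With fixed size the entries are
  coefficients or zero, and the Leibniz formula is a polynomial in them.\<close>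

lemma real_polynomial_function_resultant_sub:
  assumes "polynomial_family F" "polynomial_family G"
  shows "real_polynomial_function (\<lambda>x. resultant_sub m n (F x) (G x))"
proof -
  have entry: "real_polynomial_function (\<lambda>x. sylvester_mat_sub m n (F x) (G x) $$ (i, j))"
    if "i < m + n" "j < m + n" for i j
    unfolding sylvester_mat_sub_index[OF that] using assms real_polynomial_function.intros(2)
    by (intro real_polynomial_function_If) (auto simp: polynomial_family_def)
  have prod: "real_polynomial_function (\<lambda>x. \<Prod>i = 0..<m + n. sylvester_mat_sub m n (F x) (G x) $$ (i, \<pi> i))"
    if "\<pi> permutes {0..<m + n}" for \<pi>
  proof (intro real_polynomial_function_prod entry)
    fix i assume i: "i \<in> {0..<m + n}"
    then show "i < m + n" "\<pi> i < m + n"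
      using permutes_in_image[OF that, of i] by simp_all
  qed simp
  show ?thesis
    unfolding resultant_sub_def det_def sylvester_mat_sub_dim if_P[OF refl]
  proof (rule real_polynomial_function_sum)
    fix \<pi> assume "\<pi> \<in> {\<pi>. \<pi> permutes {0..<m + n}}"
    then show "real_polynomial_function
        (\<lambda>x. signof \<pi> * (\<Prod>i = 0..<m + n. sylvester_mat_sub m n (F x) (G x) $$ (i, \<pi> i)))"
      by (intro real_polynomial_function.intros(4)[OF real_polynomial_function.intros(2) prod]) simp
  qed (simp add: finite_permutations)
qed

text \<open>Over a field the resultant vanishes iff the gcd has positive degree. The assumption
  excludes the zero gcd, which has degree 0 without being a unit.\<close>

lemma resultant_eq_0_iff_not_coprime:
  fixes p q :: "real poly"
  assumes "p \<noteq> 0"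
  shows "resultant p q = 0 \<longleftrightarrow> \<not> coprime p q"
proof -
  have "gcd p q \<noteq> 0" using assms by simp
  then show ?thesis
    using is_unit_iff_degree[of "gcd p q"] is_unit_gcd[of p q] by (simp add: resultant_0_gcd)
qed

section \<open>The discriminant on jet space\<close>

text \<open>With \<open>t = tan \<theta>\<close>, \<open>a = f331 0\<close> and \<open>D = a\<^sup>2 + 4 t\<^sup>2\<close>, the four factors of \<open>total_poly\<close> come from the
  curve \<open>e = (2 Q / D) (0, - a, 2 t)\<close>, where \<open>Q\<close> is \<open>pedal_poly\<close>: \<open>inflection_poly\<close> is, up to a factor
  without zeros, \<open>det (e', e'')\<close> in the plane of the curve, \<open>Q\<close> times \<open>transversality_poly\<close> is the
  determinant of the projections of \<open>\<partial>h/\<partial>\<theta>\<close> and \<open>\<partial>h/\<partial>r\<close> to this plane, and \<open>unit_curvature_poly\<close>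
  vanishes where \<open>\<kappa>\<^sub>1\<^sup>2 = 1\<close>.\<close>

definition pedal_poly :: "jet_space \<Rightarrow> real poly" where
  "pedal_poly = (\<lambda>(j21, j31, j321, j322, j331). [: - (j331 $ 1 * j21 $ 1), 2 * j31 $ 1, j331 $ 1 :])"

definition inflection_poly :: "jet_space \<Rightarrow> real poly" where
  "inflection_poly = (\<lambda>(j21, j31, j321, j322, j331). let a = j331 $ 1; b = j21 $ 1; c = j31 $ 1 in
     [: 4 * a * b^2 + 4 * a * c^2 + a^3 * b, 6 * a^2 * c, 3 * a^3 + 12 * a * b, - (8 * c) :])"

definition transversality_poly :: "jet_space \<Rightarrow> real poly" where
  "transversality_poly = (\<lambda>(j21, j31, j321, j322, j331).
     [: - (j331 $ 1 * j21 $ 2), 2 * j31 $ 2, 2 * j331 $ 2, 2 * j321 $ 1, 2 * j322 $ 1 :])"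

definition unit_curvature_poly :: "jet_space \<Rightarrow> real poly" where
  "unit_curvature_poly x = Polynomial.smult 4 (pedal_poly x * pedal_poly x) - [: (snd (snd (snd (snd x))) $ 1)^2, 0, 4 :]"

definition total_poly :: "jet_space \<Rightarrow> real poly" where
  "total_poly x = inflection_poly x * (pedal_poly x * transversality_poly x) * unit_curvature_poly x"

text \<open>The first two factors are \<open>f31 0\<close> and \<open>f322 0\<close>. Up to
  constants they are the leading coefficients of \<open>inflection_poly\<close> and
  \<open>transversality_poly\<close>; those of the other two factors are positive because
  \<open>f331 0\<close> is. Hence the total degree is 3 + 2 + 4 + 4 = 13 off their zero set.\<close>

definition genericity :: "jet_space \<Rightarrow> real" where
  "genericity x = fst (snd x) $ 1 * fst (snd (snd (snd x))) $ 1 *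
     resultant_sub 13 12 (total_poly x) (pderiv (total_poly x))"

lemma degree_unit_curvature_poly:
  assumes "x \<in> umbrella_jets"
  shows "degree (unit_curvature_poly x) = 4"
  using assms
  by (auto simp: unit_curvature_poly_def umbrella_jets_def pedal_poly_def split: prod.splits)

lemma degree_geodesic_poly:
  assumes "x \<in> umbrella_jets" "fst (snd x) $ 1 \<noteq> 0" "fst (snd (snd (snd x))) $ 1 \<noteq> 0"
  shows "degree (inflection_poly x) = 3" "degree (pedal_poly x) = 2" "degree (transversality_poly x) = 4"
  using assms
  by (auto simp: inflection_poly_def transversality_poly_def umbrella_jets_def pedal_poly_def
      Let_def split: prod.splits)

lemma degree_total_poly:
  assumes "x \<in> umbrella_jets" "fst (snd x) $ 1 \<noteq> 0" "fst (snd (snd (snd x))) $ 1 \<noteq> 0"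
  shows "degree (total_poly x) = 13" "degree (pderiv (total_poly x)) = 12"
proof -
  have "inflection_poly x \<noteq> 0" "pedal_poly x \<noteq> 0" "transversality_poly x \<noteq> 0" "unit_curvature_poly x \<noteq> 0"
    using degree_geodesic_poly[OF assms] degree_unit_curvature_poly[OF assms(1)] by fastforce+
  then show "degree (total_poly x) = 13"
    using degree_geodesic_poly[OF assms] degree_unit_curvature_poly[OF assms(1)]
    by (simp add: total_poly_def degree_mult_eq)
  then show "degree (pderiv (total_poly x)) = 12"
    by (simp add: degree_pderiv)
qed

text \<open>Under these assumptions the formal degrees 13 and 12 are the actual ones, so
  \<open>resultant_sub\<close> is the genuine resultant.\<close>

lemma coprime_total_poly_iff:
  assumes "x \<in> umbrella_jets" "fst (snd x) $ 1 \<noteq> 0" "fst (snd (snd (snd x))) $ 1 \<noteq> 0"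
  shows "genericity x \<noteq> 0 \<longleftrightarrow> coprime (total_poly x) (pderiv (total_poly x))"
proof -
  have "total_poly x \<noteq> 0" using degree_total_poly[OF assms] by auto
  then show ?thesis
    using assms degree_total_poly[OF assms] resultant_eq_0_iff_not_coprime[of "total_poly x" "pderiv (total_poly x)"]
    by (simp add: genericity_def resultant_sub)
qed

lemma real_polynomial_function_jet:
  "real_polynomial_function (\<lambda>x::jet_space. fst x $ i)"
  "real_polynomial_function (\<lambda>x::jet_space. fst (snd x) $ i)"
  "real_polynomial_function (\<lambda>x::jet_space. fst (snd (snd x)) $ j)"
  "real_polynomial_function (\<lambda>x::jet_space. fst (snd (snd (snd x))) $ i)"
  "real_polynomial_function (\<lambda>x::jet_space. snd (snd (snd (snd x))) $ i)"
  by (intro real_polynomial_function.intros(1) bounded_linear_compose[OF bounded_linear_vec_nth]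
      bounded_linear_compose[OF bounded_linear_fst] bounded_linear_compose[OF bounded_linear_snd]
      bounded_linear_fst bounded_linear_snd)+

lemma real_polynomial_function_genericity: "real_polynomial_function genericity"
proof -
  note rules = polynomial_family_mult polynomial_family_smult polynomial_family_diff polynomial_family_pCons polynomial_family_const polynomial_family_pderiv
    real_polynomial_function_jet real_polynomial_function.intros(2-4) real_polynomial_function_minus
    real_polynomial_function_power
  have 1: "polynomial_family pedal_poly" "polynomial_family inflection_poly" "polynomial_family transversality_poly"
    unfolding pedal_poly_def inflection_poly_def transversality_poly_def split_beta Let_def
    by (intro rules)+
  have 2: "polynomial_family unit_curvature_poly"
    unfolding unit_curvature_poly_def[abs_def] by (intro rules 1)
  have "polynomial_family total_poly"
    unfolding total_poly_def[abs_def] by (intro rules 1 2)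
  then show ?thesis
    unfolding genericity_def[abs_def]
    by (intro rules real_polynomial_function_resultant_sub)
qed

text \<open>Values that keep the four factors simple: a = 2 and b = - 1 cancel the quadratic
  coefficient 3 a^3 + 12 a b of \<open>inflection_poly\<close>, \<open>pedal_poly\<close> becomes 2
  (1 + t + t^2), and \<open>transversality_poly\<close> becomes t^4 - 1.\<close>

definition generic_jet :: jet_space where
  "generic_jet = (vector [-1, 1/2, 0], vector [1, 0, 0], vector [0, 0], vector [1/2, 0, 0], vector [2, 0, 0])"

lemma generic_jet: "generic_jet \<in> umbrella_jets" "genericity generic_jet \<noteq> 0"
proof -
  show j: "generic_jet \<in> umbrella_jets"
    by (simp add: generic_jet_def umbrella_jets_def)
  let ?w = "[:8, 24, 0, -8:] :: real poly" and ?q = "[:2, 2, 2:] :: real poly"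
  let ?s = "[:-1, 0, 0, 0, 1:] :: real poly" and ?r = "[:12, 32, 44, 32, 16:] :: real poly"
  have P: "inflection_poly generic_jet = ?w" "pedal_poly generic_jet = ?q"
    "transversality_poly generic_jet = ?s" "unit_curvature_poly generic_jet = ?r"
    by (simp_all add: inflection_poly_def pedal_poly_def transversality_poly_def
        unit_curvature_poly_def generic_jet_def Let_def)
  \<comment> \<open>Ten Bezout identities with integer cofactors: four for the factors against their
    derivatives, six for the pairs of factors.\<close>
  have "coprime ?w (pderiv ?w)"
    by (rule coprime_by_bezout[where c = 72 and a = "[:-3, 6:]" and b = "[:4, 1, -2:]"]) (simp_all add: pderiv_pCons)
  moreover have "coprime ?q (pderiv ?q)"
    by (rule coprime_by_bezout[where c = 6 and a = "[:4:]" and b = "[:-1, -2:]"]) (simp_all add: pderiv_pCons)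
  moreover have "coprime ?s (pderiv ?s)"
    by (rule coprime_by_bezout[where c = 4 and a = "[:-4:]" and b = "[:0, 1:]"]) (simp_all add: pderiv_pCons numeral_poly)
  moreover have "coprime ?r (pderiv ?r)"
    by (rule coprime_by_bezout[where c = 1784 and a = "[:362, 424, 1008:]" and b = "[:-80, -301, -232, -252:]"]) (simp_all add: pderiv_pCons)
  moreover have "coprime ?w ?q"
    by (rule coprime_by_bezout[where c = 24 and a = "[:-1, -1:]" and b = "[:16, 0, -4:]"]) (simp_all add: pderiv_pCons)
  moreover have "coprime ?w ?s"
    by (rule coprime_by_bezout[where c = 408 and a = "[:-7, 11, -10, 23:]" and b = "[:-464, -80, 184:]"]) (simp_all add: pderiv_pCons)
  moreover have "coprime ?w ?r"
    by (rule coprime_by_bezout[where c = 15992 and a = "[:-3053, -4712, -3820, -2176:]" and b = "[:3368, 266, -1088:]"]) (simp_all add: pderiv_pCons)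
  moreover have "coprime ?q ?s"
    by (rule coprime_by_bezout[where c = 6 and a = "[:1, -2, 1, 1:]" and b = "[:-4, -2:]"]) (simp_all add: pderiv_pCons)
  moreover have "coprime ?q ?r"
    by (rule coprime_by_bezout[where c = 4 and a = "[:8, 14, 16, 8:]" and b = "[:-1, -1:]"]) (simp_all add: pderiv_pCons)
  moreover have "coprime ?s ?r"
    by (rule coprime_by_bezout[where c = 544 and a = "[:-532, -160, -48, 256:]" and b = "[:1, -16, 35, -16:]"]) (simp_all add: pderiv_pCons)
  ultimately have "coprime (total_poly generic_jet) (pderiv (total_poly generic_jet))"
    unfolding total_poly_def P
    by (intro coprime_pderiv_mult) (simp_all only: coprime_mult_left_iff coprime_mult_right_iff simp_thms)
  then show "genericity generic_jet \<noteq> 0"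
    using j by (subst coprime_total_poly_iff) (auto simp: generic_jet_def)
qed

section \<open>Derivatives of the normal form\<close>

lemma Ck_on_real_Suc:
  fixes g :: "real \<Rightarrow> real"
  assumes "Ck_on (Suc k) U g"
  shows "\<exists>g'. Ck_on k U g' \<and> (\<forall>x\<in>U. (g has_real_derivative g' x) (at x))"
proof (intro exI conjI ballI)
  show "Ck_on k U (\<lambda>x. frechet_derivative g (at x) 1)"
    using assms by simp
  fix x assume "x \<in> U"
  then have D: "(g has_derivative frechet_derivative g (at x)) (at x)"
    using assms by (simp add: frechet_derivative_works)
  then have "frechet_derivative g (at x) y = frechet_derivative g (at x) 1 * y" for y
    using linear_cmul[OF has_derivative_linear[OF D], of y 1] by (simp add: mult.commute)
  then have "frechet_derivative g (at x) = (*) (frechet_derivative g (at x) 1)" by (rule ext)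
  with D show "(g has_real_derivative frechet_derivative g (at x) 1) (at x)"
    by (simp add: has_field_derivative_def)
qed

definition has_gradient :: "(real \<times> real \<Rightarrow> real) \<Rightarrow> real \<Rightarrow> real \<Rightarrow> real \<times> real \<Rightarrow> bool" where
  "has_gradient G a b p \<longleftrightarrow> (G has_derivative (\<lambda>w. fst w * a + snd w * b)) (at p)"

lemma Ck_on_plane_Suc:
  fixes G :: "real \<times> real \<Rightarrow> real"
  assumes "Ck_on (Suc k) U G"
  shows "\<exists>Gu Gv. Ck_on k U Gu \<and> Ck_on k U Gv \<and> (\<forall>p\<in>U. has_gradient G (Gu p) (Gv p) p)"
proof (intro exI conjI ballI)
  show "Ck_on k U (pdu G)" "Ck_on k U (pdv G)"
    using assms by simp_all
  fix p assume "p \<in> U"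
  then have D: "(G has_derivative frechet_derivative G (at p)) (at p)"
    using assms by (simp add: frechet_derivative_works)
  have "frechet_derivative G (at p) w = fst w * pdu G p + snd w * pdv G p" for w
  proof -
    have "w = fst w *\<^sub>R (1, 0) + snd w *\<^sub>R (0, 1)" by (simp add: prod_eq_iff)
    then have "frechet_derivative G (at p) w
        = frechet_derivative G (at p) (fst w *\<^sub>R (1, 0) + snd w *\<^sub>R (0, 1))" by simp
    also have "\<dots> = fst w * pdu G p + snd w * pdv G p"
      using has_derivative_linear[OF D] by (simp only: linear_add linear_cmul real_scaleR_def)
    finally show ?thesis .
  qed
  then have "frechet_derivative G (at p) = (\<lambda>w. fst w * pdu G p + snd w * pdv G p)" by blast
  with D show "has_gradient G (pdu G p) (pdv G p) p"
    by (simp add: has_gradient_def)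
qed

text \<open>Three derivatives are what the argument consumes: the second fundamental form is
  differentiated once along rays.\<close>

lemma smooth_germ_real:
  fixes g :: "real \<Rightarrow> real"
  assumes "smooth_germ g"
  obtains U g1 g2 g3 where "open U" "0 \<in> U"
    "\<And>x. x \<in> U \<Longrightarrow> (g has_real_derivative g1 x) (at x)"
    "\<And>x. x \<in> U \<Longrightarrow> (g1 has_real_derivative g2 x) (at x)"
    "\<And>x. x \<in> U \<Longrightarrow> (g2 has_real_derivative g3 x) (at x)"
proof -
  obtain U where U: "open U" "0 \<in> U" "Ck_on (Suc (Suc (Suc 0))) U g"
    using assms unfolding smooth_germ_def smooth_on_def by blast
  obtain g1 where g1: "Ck_on (Suc (Suc 0)) U g1" "\<forall>x\<in>U. (g has_real_derivative g1 x) (at x)"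
    using Ck_on_real_Suc[OF U(3)] by blast
  obtain g2 where g2: "Ck_on (Suc 0) U g2" "\<forall>x\<in>U. (g1 has_real_derivative g2 x) (at x)"
    using Ck_on_real_Suc[OF g1(1)] by blast
  obtain g3 where "\<forall>x\<in>U. (g2 has_real_derivative g3 x) (at x)"
    using Ck_on_real_Suc[OF g2(1)] by blast
  then show thesis using that U g1 g2 by blast
qed

text \<open>Of the third order only differentiability at the origin is recorded: in the second
  derivatives of the normal form, the second derivatives of \<open>G\<close> carry a factor v^3, so
  their own derivatives contribute nothing there.\<close>

lemma smooth_germ_plane:
  fixes G :: "real \<times> real \<Rightarrow> real"
  assumes "smooth_germ G"
  obtains U Gu Gv Guu Guv Gvu Gvv where "open U" "0 \<in> U"
    "\<And>p. p \<in> U \<Longrightarrow> has_gradient G (Gu p) (Gv p) p"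
    "\<And>p. p \<in> U \<Longrightarrow> has_gradient Gu (Guu p) (Guv p) p"
    "\<And>p. p \<in> U \<Longrightarrow> has_gradient Gv (Gvu p) (Gvv p) p"
    "Guu differentiable (at 0)" "Guv differentiable (at 0)" "Gvv differentiable (at 0)"
proof -
  obtain U where U: "open U" "0 \<in> U" "Ck_on (Suc (Suc (Suc 0))) U G"
    using assms unfolding smooth_germ_def smooth_on_def by blast
  obtain Gu Gv where 1: "Ck_on (Suc (Suc 0)) U Gu" "Ck_on (Suc (Suc 0)) U Gv"
    "\<forall>p\<in>U. has_gradient G (Gu p) (Gv p) p"
    using Ck_on_plane_Suc[OF U(3)] by blast
  obtain Guu Guv where 2: "Ck_on (Suc 0) U Guu" "Ck_on (Suc 0) U Guv"
    "\<forall>p\<in>U. has_gradient Gu (Guu p) (Guv p) p"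
    using Ck_on_plane_Suc[OF 1(1)] by blast
  obtain Gvu Gvv where 3: "Ck_on (Suc 0) U Gvv"
    "\<forall>p\<in>U. has_gradient Gv (Gvu p) (Gvv p) p"
    using Ck_on_plane_Suc[OF 1(2)] by blast
  have "Guu differentiable (at 0)" "Guv differentiable (at 0)" "Gvv differentiable (at 0)"
    using 2 3 U(2) by auto
  then show thesis using that U 1 2 3 by blast
qed

section \<open>Partial derivatives of maps into space, computed by components\<close>

lemma vector_3_eq:
  "(vector [x, y, z] :: real^3) = x *\<^sub>R vector [1, 0, 0] + y *\<^sub>R vector [0, 1, 0] + z *\<^sub>R vector [0, 0, 1]"
  by (simp add: Finite_Cartesian_Product.vec_eq_iff forall_3)

lemma has_derivative_vector_3:
  assumes "(X has_derivative X') F" "(Y has_derivative Y') F" "(Z has_derivative Z') F"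
  shows "((\<lambda>p. vector [X p, Y p, Z p] :: real^3) has_derivative (\<lambda>w. vector [X' w, Y' w, Z' w])) F"
  by (subst (1 2) vector_3_eq) (intro has_derivative_add has_derivative_scaleR_left assms)

lemma frechet_derivative_vector_3:
  fixes F :: "real \<times> real \<Rightarrow> real^3"
  assumes "open U" "p \<in> U" "\<And>q. q \<in> U \<Longrightarrow> F q = vector [X q, Y q, Z q]"
    "has_gradient X xu xv p" "has_gradient Y yu yv p" "has_gradient Z zu zv p"
  shows "F differentiable (at p)" "pdu F p = vector [xu, yu, zu]" "pdv F p = vector [xv, yv, zv]"
proof -
  have "((\<lambda>q. vector [X q, Y q, Z q] :: real^3) has_derivative
      (\<lambda>w. vector [fst w * xu + snd w * xv, fst w * yu + snd w * yv, fst w * zu + snd w * zv])) (at p)"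
    using assms(4-6) by (intro has_derivative_vector_3) (auto simp: has_gradient_def)
  then have D: "(F has_derivative
      (\<lambda>w. vector [fst w * xu + snd w * xv, fst w * yu + snd w * yv, fst w * zu + snd w * zv])) (at p)"
    by (rule has_derivative_transform_within_open[OF _ assms(1,2)]) (simp add: assms(3))
  then show "F differentiable (at p)" by (auto simp: differentiable_def)
  show "pdu F p = vector [xu, yu, zu]" "pdv F p = vector [xv, yv, zv]"
    by (simp_all add: frechet_derivative_at[OF D, symmetric])
qed

lemma has_gradient_ray:
  assumes "has_gradient G a b (r * c, r * s)"
  shows "((\<lambda>r. G (r * c, r * s)) has_real_derivative c * a + s * b) (at r)"
proof -
  have "((\<lambda>r. (r * c, r * s)) has_derivative (\<lambda>w. (w * c, w * s))) (at r)"
    by (auto intro!: derivative_eq_intros)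
  from has_derivative_compose[OF this, of G] assms
  have "((\<lambda>r. G (r * c, r * s)) has_derivative (\<lambda>w. w * c * a + w * s * b)) (at r)"
    unfolding has_gradient_def by fastforce
  then show ?thesis
    unfolding has_field_derivative_def by (rule has_derivative_eq_rhs) (auto simp: algebra_simps)
qed

lemma has_gradient_fst:
  assumes "(g has_real_derivative D) (at (fst p))"
  shows "has_gradient (\<lambda>q. g (fst q)) D 0 p"
proof -
  have "((\<lambda>q. g (fst q)) has_derivative (\<lambda>w. D * fst w)) (at p)"
    using assms unfolding has_field_derivative_def
    by (rule has_derivative_compose[OF has_derivative_fst[OF has_derivative_ident]])
  then show ?thesis by (simp add: has_gradient_def mult.commute)
qed

lemma normal_form_gradients:
  assumes g21: "(f21 has_real_derivative f21' (fst p)) (at (fst p))" "(f21' has_real_derivative f21'' (fst p)) (at (fst p))"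
    and g31: "(f31 has_real_derivative f31' (fst p)) (at (fst p))" "(f31' has_real_derivative f31'' (fst p)) (at (fst p))"
    and g321: "(f321 has_real_derivative f321' (fst p)) (at (fst p))" "(f321' has_real_derivative f321'' (fst p)) (at (fst p))"
    and g331: "(f331 has_real_derivative f331' (fst p)) (at (fst p))" "(f331' has_real_derivative f331'' (fst p)) (at (fst p))"
    and G: "has_gradient G (Gu p) (Gv p) p" "has_gradient Gu (Guu p) (Guv p) p" "has_gradient Gv (Gvu p) (Gvv p) p"
  defines "u \<equiv> fst p" and "v \<equiv> snd p"
  shows "has_gradient fst 1 0 p"
    "has_gradient (\<lambda>(u, v). u^2 * f21 u + v^2) (2 * u * f21 u + u^2 * f21' u) (2 * v) p"
    "has_gradient (\<lambda>(u, v). 2 * u * f21 u + u^2 * f21' u) (2 * f21 u + 4 * u * f21' u + u^2 * f21'' u) 0 p"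
    "has_gradient (\<lambda>q. 2 * snd q) 0 2 p"
    "has_gradient (\<lambda>(u, v). u^2 * f31 u + v^2 * (u * f321 u + v * G (u, v)) + u * v * f331 u)
      (2 * u * f31 u + u^2 * f31' u + v^2 * (f321 u + u * f321' u) + v^3 * Gu p + v * f331 u + u * v * f331' u)
      (2 * u * v * f321 u + 3 * v^2 * G p + v^3 * Gv p + u * f331 u) p"
    "has_gradient (\<lambda>(u, v). 2 * u * f31 u + u^2 * f31' u + v^2 * (f321 u + u * f321' u) + v^3 * Gu (u, v) + v * f331 u + u * v * f331' u)
      (2 * f31 u + 4 * u * f31' u + u^2 * f31'' u + v^2 * (2 * f321' u + u * f321'' u) + v^3 * Guu p + v * (2 * f331' u + u * f331'' u))
      (2 * v * (f321 u + u * f321' u) + 3 * v^2 * Gu p + v^3 * Guv p + f331 u + u * f331' u) p"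
    "has_gradient (\<lambda>(u, v). 2 * u * v * f321 u + 3 * v^2 * G (u, v) + v^3 * Gv (u, v) + u * f331 u)
      (2 * v * f321 u + 2 * u * v * f321' u + 3 * v^2 * Gu p + v^3 * Gvu p + f331 u + u * f331' u)
      (2 * u * f321 u + 6 * v * G p + 6 * v^2 * Gv p + v^3 * Gvv p) p"
proof -
  note h = g21[THEN has_gradient_fst] g31[THEN has_gradient_fst] g321[THEN has_gradient_fst] g331[THEN has_gradient_fst] G
  note h = h[unfolded has_gradient_def]
  have [derivative_intros]: "(fst has_derivative fst) (at p)" "(snd has_derivative snd) (at p)"
    by (auto intro!: derivative_eq_intros)
  show "has_gradient fst 1 0 p"
    unfolding has_gradient_def by (auto intro!: derivative_eq_intros)
  show "has_gradient (\<lambda>(u, v). u^2 * f21 u + v^2) (2 * u * f21 u + u^2 * f21' u) (2 * v) p"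
    unfolding has_gradient_def split_beta u_def v_def
    by (rule derivative_eq_intros h refl)+ (auto simp: algebra_simps power2_eq_square power3_eq_cube)
  show "has_gradient (\<lambda>(u, v). 2 * u * f21 u + u^2 * f21' u) (2 * f21 u + 4 * u * f21' u + u^2 * f21'' u) 0 p"
    unfolding has_gradient_def split_beta u_def v_def
    by (rule derivative_eq_intros h refl)+ (auto simp: algebra_simps power2_eq_square power3_eq_cube)
  show "has_gradient (\<lambda>q. 2 * snd q) 0 2 p"
    unfolding has_gradient_def split_beta u_def v_def
    by (rule derivative_eq_intros h refl)+ (auto simp: algebra_simps power2_eq_square power3_eq_cube)
  show "has_gradient (\<lambda>(u, v). u^2 * f31 u + v^2 * (u * f321 u + v * G (u, v)) + u * v * f331 u)
      (2 * u * f31 u + u^2 * f31' u + v^2 * (f321 u + u * f321' u) + v^3 * Gu p + v * f331 u + u * v * f331' u)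
      (2 * u * v * f321 u + 3 * v^2 * G p + v^3 * Gv p + u * f331 u) p"
    unfolding has_gradient_def split_beta u_def v_def prod.collapse
    by (rule derivative_eq_intros h refl)+ (auto simp: algebra_simps power2_eq_square power3_eq_cube)
  show "has_gradient (\<lambda>(u, v). 2 * u * f31 u + u^2 * f31' u + v^2 * (f321 u + u * f321' u) + v^3 * Gu (u, v) + v * f331 u + u * v * f331' u)
      (2 * f31 u + 4 * u * f31' u + u^2 * f31'' u + v^2 * (2 * f321' u + u * f321'' u) + v^3 * Guu p + v * (2 * f331' u + u * f331'' u))
      (2 * v * (f321 u + u * f321' u) + 3 * v^2 * Gu p + v^3 * Guv p + f331 u + u * f331' u) p"
    unfolding has_gradient_def split_beta u_def v_def prod.collapse
    by (rule derivative_eq_intros h refl)+ (auto simp: algebra_simps power2_eq_square power3_eq_cube)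
  show "has_gradient (\<lambda>(u, v). 2 * u * v * f321 u + 3 * v^2 * G (u, v) + v^3 * Gv (u, v) + u * f331 u)
      (2 * v * f321 u + 2 * u * v * f321' u + 3 * v^2 * Gu p + v^3 * Gvu p + f331 u + u * f331' u)
      (2 * u * f321 u + 6 * v * G p + 6 * v^2 * Gv p + v^3 * Gvv p) p"
    unfolding has_gradient_def split_beta u_def v_def prod.collapse
    by (rule derivative_eq_intros h refl)+ (auto simp: algebra_simps power2_eq_square power3_eq_cube)
qed

section \<open>The principal curvature surface to first order\<close>

text \<open>The equations for normal and curvature are available only off the exceptional fibre,
  where \<open>f\<close> is immersed. Since the functions in them extend differentiably, each
  equation yields two conditions at r = 0: a value and a derivative.\<close>

lemma DERIV_unique_punctured_zero:
  fixes \<Phi> :: "real \<Rightarrow> real"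
  assumes "(\<Phi> has_real_derivative D) (at 0)" "\<forall>\<^sub>F r in at 0. \<Phi> r = 0"
  shows "\<Phi> 0 = 0" "D = 0"
proof -
  have "\<Phi> \<midarrow>0\<rightarrow> \<Phi> 0"
    using DERIV_isCont[OF assms(1)] by (simp add: isCont_def)
  moreover have "\<Phi> \<midarrow>0\<rightarrow> 0"
    using assms(2) by (rule tendsto_eventually)
  ultimately show 0: "\<Phi> 0 = 0" by (rule tendsto_unique[OF trivial_limit_at])
  have "(\<lambda>h. (\<Phi> (0 + h) - \<Phi> 0) / h) \<midarrow>0\<rightarrow> D"
    using assms(1) by (simp add: has_field_derivative_iff)
  moreover have "(\<lambda>h. (\<Phi> (0 + h) - \<Phi> 0) / h) \<midarrow>0\<rightarrow> 0"
    by (rule tendsto_eventually) (use assms(2) 0 in \<open>auto elim: eventually_mono\<close>)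
  ultimately show "D = 0" by (rule tendsto_unique[OF trivial_limit_at])
qed

text \<open>Along a ray, (x, y, z) is the normal and k the curvature; f_u = (1, P, Q), f_v = r (0, 2
  s, B), f_uu = (0, L2, L3), f_uv = (0, 0, M3), f_vv = (0, 2, N3). The fourth equation is det (II -
  k I) = 0. In it the entries of I that involve f_v vanish to second order at r = 0, because P and Q
  vanish there; so the term quadratic in k disappears from the value and from the first
  derivative.\<close>

lemma first_order_equations:
  fixes x y z k P Q B L2 L3 M3 N3 :: "real \<Rightarrow> real"
  assumes D: "(x has_real_derivative x1) (at 0)" "(y has_real_derivative y1) (at 0)" "(z has_real_derivative z1) (at 0)"
    "(k has_real_derivative k1) (at 0)" "(P has_real_derivative P1) (at 0)" "(Q has_real_derivative Q1) (at 0)"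
    "(B has_real_derivative B1) (at 0)" "(L2 has_real_derivative L21) (at 0)" "(L3 has_real_derivative L31) (at 0)"
    "(M3 has_real_derivative M31) (at 0)" "(N3 has_real_derivative N31) (at 0)"
    and 0: "P 0 = 0" "Q 0 = 0" "N3 0 = 0"
    and eq: "\<forall>\<^sub>F r in at 0. x r + P r * y r + Q r * z r = 0"
     "\<forall>\<^sub>F r in at 0. 2 * s * y r + B r * z r = 0"
     "\<forall>\<^sub>F r in at 0. x r ^ 2 + y r ^ 2 + z r ^ 2 = 1"
     "\<forall>\<^sub>F r in at 0. (L2 r * y r + L3 r * z r - k r * (1 + P r ^ 2 + Q r ^ 2)) *
        (2 * y r + N3 r * z r - k r * (r^2 * (4 * s^2 + B r ^ 2)))
        - (M3 r * z r - k r * (r * (2 * s * P r + B r * Q r)))^2 = 0"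
  shows "x 0 = 0" "x1 + P1 * y 0 + Q1 * z 0 = 0"
    "2 * s * y 0 + B 0 * z 0 = 0" "2 * s * y1 + B1 * z 0 + B 0 * z1 = 0"
    "y 0 ^ 2 + z 0 ^ 2 = 1" "y 0 * y1 + z 0 * z1 = 0"
    "(L2 0 * y 0 + L3 0 * z 0 - k 0) * (2 * y 0) = (M3 0 * z 0)^2"
    "(L21 * y 0 + L2 0 * y1 + L31 * z 0 + L3 0 * z1 - k1) * (2 * y 0)
      + (L2 0 * y 0 + L3 0 * z 0 - k 0) * (2 * y1 + N31 * z 0)
      = 2 * (M3 0 * z 0) * (M31 * z 0 + M3 0 * z1)"
proof -
  have "((\<lambda>r. x r + P r * y r + Q r * z r) has_real_derivative x1 + P1 * y 0 + Q1 * z 0) (at 0)"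
    by (rule derivative_eq_intros D refl)+ (simp add: 0)
  from DERIV_unique_punctured_zero[OF this eq(1)]
  show x0: "x 0 = 0" and "x1 + P1 * y 0 + Q1 * z 0 = 0" by (simp_all add: 0)
  have "((\<lambda>r. 2 * s * y r + B r * z r) has_real_derivative 2 * s * y1 + B1 * z 0 + B 0 * z1) (at 0)"
    by (rule derivative_eq_intros D refl)+ simp
  from DERIV_unique_punctured_zero[OF this eq(2)]
  show "2 * s * y 0 + B 0 * z 0 = 0" "2 * s * y1 + B1 * z 0 + B 0 * z1 = 0" by simp_all
  have "((\<lambda>r. x r ^ 2 + y r ^ 2 + z r ^ 2 - 1) has_real_derivative 2 * (y 0 * y1 + z 0 * z1)) (at 0)"
    by (rule derivative_eq_intros D refl)+ (simp add: x0 algebra_simps)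
  moreover have "\<forall>\<^sub>F r in at 0. x r ^ 2 + y r ^ 2 + z r ^ 2 - 1 = 0"
    using eq(3) by simp
  ultimately show "y 0 ^ 2 + z 0 ^ 2 = 1" "y 0 * y1 + z 0 * z1 = 0"
    using DERIV_unique_punctured_zero x0 by force+
  let ?d = "(L21 * y 0 + L2 0 * y1 + L31 * z 0 + L3 0 * z1 - k1) * (2 * y 0)
      + (L2 0 * y 0 + L3 0 * z 0 - k 0) * (2 * y1 + N31 * z 0)
      - 2 * (M3 0 * z 0) * (M31 * z 0 + M3 0 * z1)"
  have "((\<lambda>r. (L2 r * y r + L3 r * z r - k r * (1 + P r ^ 2 + Q r ^ 2)) *
        (2 * y r + N3 r * z r - k r * (r^2 * (4 * s^2 + B r ^ 2)))
        - (M3 r * z r - k r * (r * (2 * s * P r + B r * Q r)))^2) has_real_derivative ?d) (at 0)"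
    by (rule derivative_eq_intros D refl)+ (simp add: 0 algebra_simps)
  from DERIV_unique_punctured_zero[OF this eq(4)]
  show "(L2 0 * y 0 + L3 0 * z 0 - k 0) * (2 * y 0) = (M3 0 * z 0)^2"
    "(L21 * y 0 + L2 0 * y1 + L31 * z 0 + L3 0 * z1 - k1) * (2 * y 0)
      + (L2 0 * y 0 + L3 0 * z 0 - k 0) * (2 * y1 + N31 * z 0)
      = 2 * (M3 0 * z 0) * (M31 * z 0 + M3 0 * z1)"
    by (simp_all add: 0)
qed

text \<open>The equations are linear when solved in turn: the normal at r = 0 up to sign, then
  \<open>k0\<close>, then the derivative of the normal, then \<open>k1\<close>. The sign cancels
  because only products of curvature and normal enter h. Here a, a1, b20, b21, b30, b31, d, g are
  \<open>f331\<close>, its derivative, \<open>f21\<close>, its derivative, \<open>f31\<close>, its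
  derivative, \<open>f321\<close>, \<open>f322\<close> at 0. The last conclusion is the determinant,
  in the normal plane, of the t-derivative of the curve and \<partial>h/\<partial>r.\<close>

lemma first_order_solution:
  fixes a b20 b21 b30 b31 a1 d g c s t :: real
  assumes a: "a > 0" and c: "c \<noteq> 0" and s: "s = t * c"
    and e1: "x1 + 2 * c * b20 * y0 + (2 * c * b30 + s * a) * z0 = 0"
    and e2: "2 * s * y0 + c * a * z0 = 0" "2 * s * y1 + (c^2 * a1 + 2 * c * s * d + 3 * s^2 * g) * z0 + c * a * z1 = 0"
    and e3: "y0^2 + z0^2 = 1" "y0 * y1 + z0 * z1 = 0"
    and e4: "(2 * b20 * y0 + 2 * b30 * z0 - k0) * (2 * y0) = (a * z0)^2"
      "(6 * c * b21 * y0 + 2 * b20 * y1 + (6 * c * b31 + 2 * s * a1) * z0 + 2 * b30 * z1 - k1) * (2 * y0)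
        + (2 * b20 * y0 + 2 * b30 * z0 - k0) * (2 * y1 + (2 * c * d + 6 * s * g) * z0)
        = 2 * (a * z0) * ((2 * s * d + 2 * c * a1) * z0 + a * z1)"
  defines "\<Delta> \<equiv> a^2 + 4 * t^2" and "Q \<equiv> a * t^2 + 2 * b30 * t - a * b20"
    and "S \<equiv> 2 * g * t^4 + 2 * d * t^3 + 2 * a1 * t^2 + 2 * b31 * t - a * b21"
  defines "\<rho> \<equiv> 2 * Q / \<Delta>" and "\<rho>' \<equiv> (2 * (2 * a * t + 2 * b30) * \<Delta> - 16 * t * Q) / \<Delta>^2"
  shows "k0 * y0 = - a * \<rho>" "k0 * z0 = 2 * t * \<rho>" "c + k0 * x1 = c * (1 - 4 * Q^2 / \<Delta>)"
    "- a * \<rho>' * (k1 * z0 + k0 * z1) - (2 * \<rho> + 2 * t * \<rho>') * (k1 * y0 + k0 * y1)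
      = 24 * a * c * Q * S / \<Delta>^2"
proof -
  \<comment> \<open>\<open>c^2 * K\<close> is the derivative of \<open>B\<close> at 0.
    \<open>\<Omega>\<close> satisfies
    \<open>\<rho>' = 2 * (a * \<Omega> - 4 * t * Q) / \<Delta>^2\<close> and occurs again in
    \<open>k1\<close>, which prepares the final cancellation.\<close>
  define K where "K = a1 + 2 * t * d + 3 * t^2 * g"
  define \<Omega> where "\<Omega> = 4 * t * b20 + 2 * a * b30 + 4 * t^3 + 2 * a^2 * t"
  have \<Delta>: "\<Delta> > 0" using a by (simp add: \<Delta>_def add_pos_nonneg)
  define i where "i = inverse \<Delta>"
  have i: "\<Delta> * i = 1" using \<Delta> by (simp add: i_def)
  \<comment> \<open>The normal at r = 0 is \<open>\<tau>\<close> times (0, a, - 2 t), with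
    \<open>\<tau>^2 = 1 / \<Delta>\<close>; the sign of \<open>\<tau>\<close> is the choice of unit
    normal.\<close>
  define \<tau> where "\<tau> = y0 / a"
  have y0: "y0 = a * \<tau>" using a by (simp add: \<tau>_def)
  have "(c * a) * (z0 + 2 * t * \<tau>) = 0" using e2(1) by (simp add: y0 s algebra_simps)
  then have z0: "z0 = - 2 * t * \<tau>" using c a by simp
  have "\<tau> * \<tau> * \<Delta> = y0^2 + z0^2"
    by (simp add: y0 z0 \<Delta>_def algebra_simps power2_eq_square)
  then have "\<tau> * \<tau> * (\<Delta> * i) = i" by (simp add: e3 mult.assoc[symmetric])
  then have \<tau>\<tau>: "\<tau> * \<tau> = i" by (simp add: i)
  then have \<tau>: "\<tau> \<noteq> 0" using i by auto
  have "(2 * a * \<tau>) * (k0 + 2 * \<tau> * Q) = 0"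
    using e4(1) by (simp add: y0 z0 Q_def algebra_simps power2_eq_square)
  then have k0: "k0 = - 2 * \<tau> * Q" using a \<tau> by simp
  have \<rho>: "\<rho> = 2 * Q * i" by (simp add: \<rho>_def i_def divide_inverse)
  have "k0 * y0 = - 2 * a * Q * (\<tau> * \<tau>)" "k0 * z0 = 4 * t * Q * (\<tau> * \<tau>)"
    by (simp_all add: k0 y0 z0)
  then show "k0 * y0 = - a * \<rho>" "k0 * z0 = 2 * t * \<rho>"
    by (simp_all add: \<tau>\<tau> \<rho>)
  have "x1 = - c * k0"
    using e1 by (simp add: k0 s y0 z0 Q_def algebra_simps power2_eq_square)
  moreover have "k0 * k0 = 4 * Q^2 * (\<tau> * \<tau>)"
    by (simp add: k0 power2_eq_square)
  ultimately have "c + k0 * x1 = c * (1 - 4 * Q^2 * (\<tau> * \<tau>))"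
    by (simp add: algebra_simps)
  then show "c + k0 * x1 = c * (1 - 4 * Q^2 / \<Delta>)"
    by (simp add: \<tau>\<tau> i_def divide_inverse)
  \<comment> \<open>The plane part of the derivative of a unit normal is orthogonal to the normal,
    hence \<open>\<upsilon>\<close> times (2 t, a).\<close>
  define \<upsilon> where "\<upsilon> = z1 / a"
  have z1: "z1 = a * \<upsilon>" using a by (simp add: \<upsilon>_def)
  have "(a * \<tau>) * (y1 - 2 * t * \<upsilon>) = 0" using e3(2) by (simp add: y0 z0 z1 algebra_simps)
  then have y1: "y1 = 2 * t * \<upsilon>" using a \<tau> by simp
  define w where "w = 2 * t * K * i"
  have "c * (\<upsilon> * \<Delta> - 2 * t * \<tau> * K * c) = 0"
    using e2(2) by (simp add: y1 z0 z1 s K_def \<Delta>_def algebra_simps power2_eq_square)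
  then have "\<upsilon> * \<Delta> = 2 * t * \<tau> * K * c" using c by simp
  then have "\<upsilon> * (\<Delta> * i) = 2 * t * \<tau> * K * c * i" by (simp add: mult.assoc[symmetric])
  then have \<upsilon>: "\<upsilon> = \<tau> * w * c" by (simp add: i w_def)
  have L: "2 * b20 * y0 + 2 * b30 * z0 - k0 = 2 * t^2 * y0"
    by (simp add: k0 y0 z0 Q_def algebra_simps power2_eq_square)
  have "(2 * a * \<tau>) * (k1 - (6 * c * b21 * y0 + 2 * b20 * y1 + (6 * c * b31 + 2 * s * a1) * z0 + 2 * b30 * z1
      + t^2 * (2 * y1 + (2 * c * d + 6 * s * g) * z0) + 2 * t * ((2 * s * d + 2 * c * a1) * z0 + a * z1))) = 0"
    using e4(2) unfolding L by (simp add: y0 z0 algebra_simps power2_eq_square)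
  then have "k1 = 6 * c * b21 * y0 + 2 * b20 * y1 + (6 * c * b31 + 2 * s * a1) * z0 + 2 * b30 * z1
      + t^2 * (2 * y1 + (2 * c * d + 6 * s * g) * z0) + 2 * t * ((2 * s * d + 2 * c * a1) * z0 + a * z1)"
    using a \<tau> by simp
  also have "\<dots> = - c * \<tau> * (6 * S - w * \<Omega>)"
    by (simp add: y1 z1 y0 z0 \<upsilon> s S_def \<Omega>_def algebra_simps power2_eq_square power3_eq_cube power4_eq_xxxx)
  finally have k1: "k1 = - c * \<tau> * (6 * S - w * \<Omega>)" .
  define X where "X = 6 * S - w * \<Omega>"
  have "k1 * z0 + k0 * z1 = c * (2 * t * X - 2 * a * Q * w) * (\<tau> * \<tau>)"
    "k1 * y0 + k0 * y1 = c * (- a * X - 4 * t * Q * w) * (\<tau> * \<tau>)"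
    unfolding k1 X_def[symmetric] by (simp_all add: y0 z0 k0 y1 z1 \<upsilon> algebra_simps)
  note H = this[unfolded \<tau>\<tau>]
  have "2 * (2 * a * t + 2 * b30) * \<Delta> - 16 * t * Q = 2 * (a * \<Omega> - 4 * t * Q)"
    by (simp add: \<Delta>_def \<Omega>_def Q_def algebra_simps power2_eq_square power3_eq_cube)
  then have \<rho>': "\<rho>' = 2 * (a * \<Omega> - 4 * t * Q) * i^2"
    by (simp add: \<rho>'_def i_def divide_inverse power_inverse)
  have "2 * \<rho> = 4 * Q * \<Delta> * i^2"
    using i by (simp add: \<rho> power2_eq_square mult.assoc)
  then have "- a * \<rho>' * (k1 * z0 + k0 * z1) - (2 * \<rho> + 2 * t * \<rho>') * (k1 * y0 + k0 * y1)
    = c * (- 2 * a * (a * \<Omega> - 4 * t * Q) * (2 * t * X - 2 * a * Q * w)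
      + (4 * Q * \<Delta> + 4 * t * (a * \<Omega> - 4 * t * Q)) * (a * X + 4 * t * Q * w)) * (i * i^2)"
    unfolding H \<rho>' by (simp add: algebra_simps)
  also have "- 2 * a * (a * \<Omega> - 4 * t * Q) * (2 * t * X - 2 * a * Q * w)
      + (4 * Q * \<Delta> + 4 * t * (a * \<Omega> - 4 * t * Q)) * (a * X + 4 * t * Q * w) = 4 * a * Q * \<Delta> * (X + \<Omega> * w)"
    by (simp add: \<Delta>_def algebra_simps power2_eq_square)
  \<comment> \<open>The turning \<open>w\<close> of the normal drops out of the determinant; only
    \<open>S\<close> survives.\<close>
  also have "X + \<Omega> * w = 6 * S" by (simp add: X_def)
  also have "c * (4 * a * Q * \<Delta> * (6 * S)) * (i * i^2) = 24 * a * c * Q * S * i^2 * (\<Delta> * i)"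
    by simp
  finally show "- a * \<rho>' * (k1 * z0 + k0 * z1) - (2 * \<rho> + 2 * t * \<rho>') * (k1 * y0 + k0 * y1)
      = 24 * a * c * Q * S / \<Delta>^2"
    unfolding i by (simp add: i_def divide_inverse power_inverse)
qed

text \<open>Only values and gradients at the origin are kept of the second derivatives, since
  nothing more enters to first order in r. The last item divides the third component of f_v by r:
  f_v vanishes at the origin, and its quotient still restricts the normal there.\<close>

lemma normal_form_derivatives:
  assumes "normal_form f f21 f31 f321 f322 f331"
  obtains V Y Yu Yuu Z Zu Zv Zuu Zuv Zvv where
    "open V" "(0::real \<times> real) \<in> V"
    "\<And>p. p \<in> V \<Longrightarrow> f p = vector [fst p, Y p, Z p]"
    "\<And>p. p \<in> V \<Longrightarrow> f differentiable (at p)"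
    "\<And>p. p \<in> V \<Longrightarrow> pdu f p = vector [1, Yu p, Zu p]"
    "\<And>p. p \<in> V \<Longrightarrow> pdv f p = vector [0, 2 * snd p, Zv p]"
    "\<And>p. p \<in> V \<Longrightarrow> pdu (pdu f) p = vector [0, Yuu p, Zuu p]"
    "\<And>p. p \<in> V \<Longrightarrow> pdv (pdu f) p = vector [0, 0, Zuv p]"
    "\<And>p. p \<in> V \<Longrightarrow> pdv (pdv f) p = vector [0, 2, Zvv p]"
    "has_gradient Y 0 0 0" "has_gradient Z 0 0 0" "Y 0 = 0" "Z 0 = 0"
    "Yu 0 = 0" "has_gradient Yu (2 * f21 0) 0 0"
    "Zu 0 = 0" "has_gradient Zu (2 * f31 0) (f331 0) 0"
    "Yuu 0 = 2 * f21 0" "has_gradient Yuu (6 * deriv f21 0) 0 0"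
    "Zuu 0 = 2 * f31 0" "has_gradient Zuu (6 * deriv f31 0) (2 * deriv f331 0) 0"
    "Zuv 0 = f331 0" "has_gradient Zuv (2 * deriv f331 0) (2 * f321 0) 0"
    "Zvv 0 = 0" "has_gradient Zvv (2 * f321 0) (6 * f322 0) 0"
    "\<And>c s. \<exists>B. B 0 = c * f331 0 \<and>
      (B has_real_derivative c^2 * deriv f331 0 + 2 * c * s * f321 0 + 3 * s^2 * f322 0) (at 0) \<and>
      (\<forall>r. Zv (r * c, r * s) = r * B r)"
proof -
  have sm: "smooth_germ f21" "smooth_germ f31" "smooth_germ f321" "smooth_germ f322" "smooth_germ f331"
    and ev: "\<forall>\<^sub>F (u, v) in nhds 0. f (u, v) = vector
        [u, u\<^sup>2 * f21 u + v\<^sup>2, u\<^sup>2 * f31 u + v\<^sup>2 * (u * f321 u + v * f322 (u, v)) + u * v * f331 u]"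
    using assms by (simp_all add: normal_form_def)
  obtain Ua f21' f21'' f21''' where A: "open Ua" "0 \<in> Ua"
    "\<And>x. x \<in> Ua \<Longrightarrow> (f21 has_real_derivative f21' x) (at x)"
    "\<And>x. x \<in> Ua \<Longrightarrow> (f21' has_real_derivative f21'' x) (at x)"
    "\<And>x. x \<in> Ua \<Longrightarrow> (f21'' has_real_derivative f21''' x) (at x)"
    using smooth_germ_real[OF sm(1)] by blast
  obtain Ub f31' f31'' f31''' where B: "open Ub" "0 \<in> Ub"
    "\<And>x. x \<in> Ub \<Longrightarrow> (f31 has_real_derivative f31' x) (at x)"
    "\<And>x. x \<in> Ub \<Longrightarrow> (f31' has_real_derivative f31'' x) (at x)"
    "\<And>x. x \<in> Ub \<Longrightarrow> (f31'' has_real_derivative f31''' x) (at x)"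
    using smooth_germ_real[OF sm(2)] by blast
  obtain Uc f321' f321'' f321''' where C: "open Uc" "0 \<in> Uc"
    "\<And>x. x \<in> Uc \<Longrightarrow> (f321 has_real_derivative f321' x) (at x)"
    "\<And>x. x \<in> Uc \<Longrightarrow> (f321' has_real_derivative f321'' x) (at x)"
    "\<And>x. x \<in> Uc \<Longrightarrow> (f321'' has_real_derivative f321''' x) (at x)"
    using smooth_germ_real[OF sm(3)] by blast
  obtain Ud f331' f331'' f331''' where D: "open Ud" "0 \<in> Ud"
    "\<And>x. x \<in> Ud \<Longrightarrow> (f331 has_real_derivative f331' x) (at x)"
    "\<And>x. x \<in> Ud \<Longrightarrow> (f331' has_real_derivative f331'' x) (at x)"
    "\<And>x. x \<in> Ud \<Longrightarrow> (f331'' has_real_derivative f331''' x) (at x)"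
    using smooth_germ_real[OF sm(5)] by blast
  obtain Ue Gu Gv Guu Guv Gvu Gvv where E: "open Ue" "0 \<in> Ue"
    "\<And>p. p \<in> Ue \<Longrightarrow> has_gradient f322 (Gu p) (Gv p) p"
    "\<And>p. p \<in> Ue \<Longrightarrow> has_gradient Gu (Guu p) (Guv p) p"
    "\<And>p. p \<in> Ue \<Longrightarrow> has_gradient Gv (Gvu p) (Gvv p) p"
    "Guu differentiable (at 0)" "Guv differentiable (at 0)" "Gvv differentiable (at 0)"
    using smooth_germ_plane[OF sm(4)] by blast
  let ?Y = "\<lambda>(u, v). u^2 * f21 u + v^2 :: real"
  let ?Z = "\<lambda>(u, v). u^2 * f31 u + v^2 * (u * f321 u + v * f322 (u, v)) + u * v * f331 u"
  obtain Uf where F: "open Uf" "0 \<in> Uf" "\<And>p. p \<in> Uf \<Longrightarrow> f p = vector [fst p, ?Y p, ?Z p]"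
    using ev unfolding eventually_nhds split_beta by (auto simp: split_beta)
  define V where "V = Uf \<inter> Ue \<inter> ((Ua \<inter> Ub \<inter> Uc \<inter> Ud) \<times> UNIV)"
  have V: "open V" "0 \<in> V"
    using A B C D E F by (auto simp: V_def zero_prod_def intro!: open_Int open_Times)
  define Yu where "Yu = (\<lambda>(u, v::real). 2 * u * f21 u + u^2 * f21' u)"
  define Yuu where "Yuu = (\<lambda>(u, v::real). 2 * f21 u + 4 * u * f21' u + u^2 * f21'' u)"
  define Zu where "Zu = (\<lambda>(u, v). 2 * u * f31 u + u^2 * f31' u + v^2 * (f321 u + u * f321' u) + v^3 * Gu (u, v)
      + v * f331 u + u * v * f331' u)"
  define Zv where "Zv = (\<lambda>(u, v). 2 * u * v * f321 u + 3 * v^2 * f322 (u, v) + v^3 * Gv (u, v) + u * f331 u)"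
  define Zuu where "Zuu = (\<lambda>(u, v). 2 * f31 u + 4 * u * f31' u + u^2 * f31'' u + v^2 * (2 * f321' u + u * f321'' u)
      + v^3 * Guu (u, v) + v * (2 * f331' u + u * f331'' u))"
  define Zuv where "Zuv = (\<lambda>(u, v). 2 * v * (f321 u + u * f321' u) + 3 * v^2 * Gu (u, v) + v^3 * Guv (u, v)
      + f331 u + u * f331' u)"
  define Zvu where "Zvu = (\<lambda>(u, v). 2 * v * f321 u + 2 * u * v * f321' u + 3 * v^2 * Gu (u, v) + v^3 * Gvu (u, v)
      + f331 u + u * f331' u)"
  define Zvv where "Zvv = (\<lambda>(u, v). 2 * u * f321 u + 6 * v * f322 (u, v) + 6 * v^2 * Gv (u, v) + v^3 * Gvv (u, v))"
  have grad: "has_gradient fst 1 0 p" "has_gradient ?Y (Yu p) (2 * snd p) p" "has_gradient Yu (Yuu p) 0 p"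
    "has_gradient (\<lambda>q. 2 * snd q) 0 2 p" "has_gradient ?Z (Zu p) (Zv p) p"
    "has_gradient Zu (Zuu p) (Zuv p) p" "has_gradient Zv (Zvu p) (Zvv p) p" if "p \<in> V" for p
  proof -
    have p: "fst p \<in> Ua" "fst p \<in> Ub" "fst p \<in> Uc" "fst p \<in> Ud" "p \<in> Ue"
      using that by (auto simp: V_def)
    note g = normal_form_gradients[where p = p and ?f21.0 = f21 and f21' = f21'
      and f21'' = f21'' and ?f31.0 = f31 and f31' = f31'
      and f31'' = f31'' and ?f321.0 = f321 and f321' = f321'
      and f321'' = f321'' and ?f331.0 = f331 and f331' = f331'
      and f331'' = f331'' and Gu = Gu and Gv = Gv
      and Guu = Guu and Guv = Guv and Gvu = Gvu
      and Gvv = Gvv and G = f322,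
      OF A(3,4)[OF p(1)] B(3,4)[OF p(2)] C(3,4)[OF p(3)] D(3,4)[OF p(4)] E(3-5)[OF p(5)]]
    show "has_gradient fst 1 0 p" "has_gradient ?Y (Yu p) (2 * snd p) p" "has_gradient Yu (Yuu p) 0 p"
    "has_gradient (\<lambda>q. 2 * snd q) 0 2 p" "has_gradient ?Z (Zu p) (Zv p) p"
    "has_gradient Zu (Zuu p) (Zuv p) p" "has_gradient Zv (Zvu p) (Zvv p) p"
      using g unfolding Yu_def Yuu_def Zu_def Zv_def Zuu_def Zuv_def Zvu_def Zvv_def
      by (simp_all add: split_beta)
  qed
  have const: "has_gradient (\<lambda>_. b) 0 0 p" for b p
    by (simp add: has_gradient_def)
  have f: "f p = vector [fst p, ?Y p, ?Z p]" if "p \<in> V" for p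
    using F(3) that by (simp add: V_def)
  have d1: "f differentiable (at p)" "pdu f p = vector [1, Yu p, Zu p]" "pdv f p = vector [0, 2 * snd p, Zv p]"
    if "p \<in> V" for p
    using frechet_derivative_vector_3[OF V(1) that f grad(1,2,5)[OF that]] by auto
  have d2: "pdu (pdu f) p = vector [0, Yuu p, Zuu p]" "pdv (pdu f) p = vector [0, 0, Zuv p]" if "p \<in> V" for p
    using frechet_derivative_vector_3[OF V(1) that d1(2) const grad(3,6)[OF that]] by auto
  have d3: "pdv (pdv f) p = vector [0, 2, Zvv p]" if "p \<in> V" for p
    using frechet_derivative_vector_3[OF V(1) that d1(3) const grad(4,7)[OF that]] by auto
  have der: "f21' 0 = deriv f21 0" "f31' 0 = deriv f31 0" "f331' 0 = deriv f331 0"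
    using A(3)[OF A(2)] B(3)[OF B(2)] D(3)[OF D(2)] by (simp_all add: DERIV_imp_deriv)
  have G': "(f21 has_real_derivative f21' 0) (at (fst (0 :: real \<times> real)))"
      "(f21' has_real_derivative f21'' 0) (at (fst (0 :: real \<times> real)))"
      "(f21'' has_real_derivative f21''' 0) (at (fst (0 :: real \<times> real)))"
      "(f31 has_real_derivative f31' 0) (at (fst (0 :: real \<times> real)))"
      "(f31' has_real_derivative f31'' 0) (at (fst (0 :: real \<times> real)))"
      "(f31'' has_real_derivative f31''' 0) (at (fst (0 :: real \<times> real)))"
      "(f321 has_real_derivative f321' 0) (at (fst (0 :: real \<times> real)))"
      "(f321' has_real_derivative f321'' 0) (at (fst (0 :: real \<times> real)))"
      "(f321'' has_real_derivative f321''' 0) (at (fst (0 :: real \<times> real)))"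
      "(f331 has_real_derivative f331' 0) (at (fst (0 :: real \<times> real)))"
      "(f331' has_real_derivative f331'' 0) (at (fst (0 :: real \<times> real)))"
      "(f331'' has_real_derivative f331''' 0) (at (fst (0 :: real \<times> real)))"
    using A(2-5) B(2-5) C(2-5) D(2-5) by auto
  note h = G'[THEN has_gradient_fst] E(3-5)[OF E(2)]
  note h = h[unfolded has_gradient_def]
    E(6-8)[unfolded frechet_derivative_works]
  have zs: "fst (0 :: real \<times> real) = 0" "snd (0 :: real \<times> real) = 0" "(0 :: real, 0 :: real) = 0"
    by (simp_all add: zero_prod_def)
  have [derivative_intros]: "(fst has_derivative fst) (at (0 :: real \<times> real))" "(snd has_derivative snd) (at (0 :: real \<times> real))"
    by (auto intro!: derivative_eq_intros)
  have g0: "has_gradient Yuu (6 * deriv f21 0) 0 0"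
     "has_gradient Zuu (6 * deriv f31 0) (2 * deriv f331 0) 0"
     "has_gradient Zuv (2 * deriv f331 0) (2 * f321 0) 0"
     "has_gradient Zvv (2 * f321 0) (6 * f322 0) 0"
    unfolding has_gradient_def Yuu_def Zuu_def Zuv_def Zvv_def split_beta prod.collapse
    by ((rule derivative_eq_intros h refl)+, auto simp: zs der algebra_simps)+
  have Bex: "\<exists>B. B 0 = c * f331 0 \<and>
      (B has_real_derivative c^2 * deriv f331 0 + 2 * c * s * f321 0 + 3 * s^2 * f322 0) (at 0) \<and>
      (\<forall>r. Zv (r * c, r * s) = r * B r)" for c s
  proof (intro exI conjI allI)
    \<comment> \<open>Each term of \<open>Zv\<close> has a factor u or v, hence a factor r, which is
      removed term by term.\<close>
    let ?B = "\<lambda>r. 2 * r * (c * s * f321 (r * c)) + 3 * s^2 * r * f322 (r * c, r * s)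
      + s^3 * r^2 * Gv (r * c, r * s) + c * f331 (r * c)"
    show "?B 0 = c * f331 0" by simp
    have r: "((\<lambda>r. f322 (r * c, r * s)) has_real_derivative c * Gu 0 + s * Gv 0) (at 0)"
      "((\<lambda>r. Gv (r * c, r * s)) has_real_derivative c * Gvu 0 + s * Gvv 0) (at 0)"
      using E(3,5)[OF E(2)] by (auto intro!: has_gradient_ray simp: zs)
    have comp: "((\<lambda>r. g (r * c)) has_real_derivative g' * c) (at 0)"
      if "(g has_real_derivative g') (at 0)" for g g'
      by (rule DERIV_chain2[where f = g]) (use that in \<open>auto intro!: derivative_eq_intros\<close>)
    note r = r comp[OF C(3)[OF C(2)]] comp[OF D(3)[OF D(2)]]
    show "(?B has_real_derivative c^2 * deriv f331 0 + 2 * c * s * f321 0 + 3 * s^2 * f322 0) (at 0)"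
      by (rule derivative_eq_intros r refl)+ (simp add: zs der power2_eq_square algebra_simps)
    show "Zv (r * c, r * s) = r * ?B r" for r
      by (simp add: Zv_def power2_eq_square power3_eq_cube algebra_simps)
  qed
  have vals: "?Y 0 = 0" "?Z 0 = 0" "Yu 0 = 0" "Zu 0 = 0" "Zv 0 = 0" "Yuu 0 = 2 * f21 0" "Zuu 0 = 2 * f31 0"
    "Zuv 0 = f331 0" "Zvv 0 = 0"
    by (simp_all add: Yu_def Zu_def Zv_def Yuu_def Zuu_def Zuv_def Zvv_def zs split_beta)
  have gs: "has_gradient ?Y 0 0 0" "has_gradient ?Z 0 0 0"
    "has_gradient Yu (2 * f21 0) 0 0" "has_gradient Zu (2 * f31 0) (f331 0) 0"
    using grad[OF V(2)] by (simp_all only: vals zs mult_zero_right)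
  show thesis
    by (rule that[OF V f d1 d2 d3 gs(1,2) vals(1-3) gs(3) vals(4) gs(4) vals(6) g0(1) vals(7) g0(2)
        vals(8) g0(3) vals(9) g0(4) Bex])
qed

section \<open>Restriction to rays and to the exceptional fibre\<close>

lemma DERIV_vec_nth_fst:
  fixes F :: "real \<times> real \<Rightarrow> real^3"
  assumes "F differentiable (at (0, \<theta>))"
  shows "((\<lambda>r. F (r, \<theta>) $ i) has_real_derivative pdu F (0, \<theta>) $ i) (at 0)"
proof -
  have D: "(F has_derivative frechet_derivative F (at (0, \<theta>))) (at (0, \<theta>))"
    using assms by (simp add: frechet_derivative_works)
  have "((\<lambda>r. (r, \<theta>)) has_derivative (\<lambda>w. (w, 0))) (at 0)"
    by (auto intro!: derivative_eq_intros)
  note has_derivative_compose[where g = F, OF this D]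
  then have "((\<lambda>r. F (r, \<theta>) $ i) has_derivative (\<lambda>w. frechet_derivative F (at (0, \<theta>)) (w, 0) $ i)) (at 0)"
    by (rule has_derivative_compose[OF _ bounded_linear_imp_has_derivative[OF bounded_linear_vec_nth]])
  moreover have "(\<lambda>w. frechet_derivative F (at (0, \<theta>)) (w, 0) $ i) = (*) (pdu F (0, \<theta>) $ i)"
  proof
    fix w :: real
    have "frechet_derivative F (at (0, \<theta>)) (w, 0) = w *\<^sub>R pdu F (0, \<theta>)"
      using linear_cmul[OF has_derivative_linear[OF D], of w "(1, 0)"] by simp
    then show "frechet_derivative F (at (0, \<theta>)) (w, 0) $ i = pdu F (0, \<theta>) $ i * w"
      by (metis mult.commute real_scaleR_def vector_scaleR_component)
  qed
  ultimately show ?thesis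
    by (simp only: has_field_derivative_def)
qed

lemma has_vector_derivative_snd:
  fixes F :: "real \<times> real \<Rightarrow> real^3"
  assumes "F differentiable (at (0, \<theta>))"
  shows "((\<lambda>s. F (0, s)) has_vector_derivative pdv F (0, \<theta>)) (at \<theta>)"
proof -
  have D: "(F has_derivative frechet_derivative F (at (0, \<theta>))) (at (0, \<theta>))"
    using assms by (simp add: frechet_derivative_works)
  have "((\<lambda>s. (0, s)) has_derivative (\<lambda>w. (0, w))) (at \<theta>)"
    by (auto intro!: derivative_eq_intros)
  note has_derivative_compose[where g = F, OF this D]
  moreover have "(\<lambda>w. frechet_derivative F (at (0, \<theta>)) (0, w)) = (\<lambda>w. w *\<^sub>R pdv F (0, \<theta>))"
    (is "?l = ?r")
  proof
    show "?l w = ?r w" for w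
      using linear_cmul[OF has_derivative_linear[OF D], of w "(0, 1)"] by simp
  qed
  ultimately show ?thesis
    by (simp only: has_vector_derivative_def)
qed

text \<open>Fixing \<theta> turns the defining conditions into equations in r alone, to which the
  two preceding computations apply with s = t c for the sine and cosine. At r = 0 the position is
  the curvature times the normal because f vanishes at the origin.\<close>

lemma principal_curvature_surface_along_E0:
  assumes nf: "normal_form f f21 f31 f321 f322 f331"
    and pcs: "principal_curvature_surface f h" and c: "cos \<theta> \<noteq> 0"
  defines "a \<equiv> f331 0" and "t \<equiv> tan \<theta>"
  defines "\<Delta> \<equiv> a^2 + 4 * t^2" and "Q \<equiv> a * t^2 + 2 * f31 0 * t - a * f21 0"
    and "S \<equiv> 2 * f322 0 * t^4 + 2 * f321 0 * t^3 + 2 * deriv f331 0 * t^2 + 2 * deriv f31 0 * t - a * deriv f21 0"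
  defines "\<rho> \<equiv> 2 * Q / \<Delta>" and "\<rho>' \<equiv> (2 * (2 * a * t + 2 * f31 0) * \<Delta> - 16 * t * Q) / \<Delta>^2"
  shows "exceptional_curve h \<theta> = vector [0, - a * \<rho>, 2 * t * \<rho>]"
    "(\<lambda>p. h (abs_blowup p)) differentiable (at (0, \<theta>))"
    "\<exists>Hy Hz. pdu (\<lambda>p. h (abs_blowup p)) (0, \<theta>) = vector [cos \<theta> * (1 - 4 * Q^2 / \<Delta>), Hy, Hz] \<and>
      - a * \<rho>' * Hz - (2 * \<rho> + 2 * t * \<rho>') * Hy = 24 * a * cos \<theta> * Q * S / \<Delta>^2"
proof -
  have a: "a > 0" using nf by (simp add: normal_form_def a_def)
  obtain U \<nu> \<kappa> where U: "open U" "abs_blowup -` blowup_E0 \<subseteq> U" "smooth_on U \<nu>" "smooth_on U \<kappa>"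
    and normal: "\<And>p. p \<in> U \<Longrightarrow> fst p \<noteq> 0 \<Longrightarrow> unit_normal_at f (blow_down p) (\<nu> p) \<and>
        principal_curvature_at f (blow_down p) (\<nu> p) (\<kappa> p)"
    and h: "\<And>p. p \<in> U \<Longrightarrow> h (abs_blowup p) = f (blow_down p) + \<kappa> p *\<^sub>R \<nu> p"
    using pcs unfolding principal_curvature_surface_def by blast
  have p0: "(0, \<theta>) \<in> U"
    using U(2) c by (auto simp: blowup_E0_def)
  have diff: "\<nu> differentiable (at (0, \<theta>))" "\<kappa> differentiable (at (0, \<theta>))"
  proof -
    have "Ck_on (Suc 0) U \<nu>" "Ck_on (Suc 0) U \<kappa>"
      using U(3,4) unfolding smooth_on_def by blast+
    then show "\<nu> differentiable (at (0, \<theta>))" "\<kappa> differentiable (at (0, \<theta>))"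
      using p0 by simp_all
  qed
  obtain V Y Yu Yuu Z Zu Zv Zuu Zuv Zvv where V: "open V" "(0::real \<times> real) \<in> V"
    and f: "\<And>p. p \<in> V \<Longrightarrow> f p = vector [fst p, Y p, Z p]"
    and fd: "\<And>p. p \<in> V \<Longrightarrow> f differentiable (at p)"
    and f1: "\<And>p. p \<in> V \<Longrightarrow> pdu f p = vector [1, Yu p, Zu p]"
    "\<And>p. p \<in> V \<Longrightarrow> pdv f p = vector [0, 2 * snd p, Zv p]"
    and f2: "\<And>p. p \<in> V \<Longrightarrow> pdu (pdu f) p = vector [0, Yuu p, Zuu p]"
    "\<And>p. p \<in> V \<Longrightarrow> pdv (pdu f) p = vector [0, 0, Zuv p]"
    "\<And>p. p \<in> V \<Longrightarrow> pdv (pdv f) p = vector [0, 2, Zvv p]"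
    and YZ: "has_gradient Y 0 0 0" "has_gradient Z 0 0 0" "Y 0 = 0" "Z 0 = 0"
    and val: "Yu 0 = 0" "Zu 0 = 0" "Yuu 0 = 2 * f21 0" "Zuu 0 = 2 * f31 0" "Zuv 0 = f331 0" "Zvv 0 = 0"
    and grad: "has_gradient Yu (2 * f21 0) 0 0" "has_gradient Zu (2 * f31 0) (f331 0) 0"
    "has_gradient Yuu (6 * deriv f21 0) 0 0"
    "has_gradient Zuu (6 * deriv f31 0) (2 * deriv f331 0) 0"
    "has_gradient Zuv (2 * deriv f331 0) (2 * f321 0) 0"
    "has_gradient Zvv (2 * f321 0) (6 * f322 0) 0"
    and ZvB: "\<And>c s. \<exists>B. B 0 = c * f331 0 \<and>
      (B has_real_derivative c^2 * deriv f331 0 + 2 * c * s * f321 0 + 3 * s^2 * f322 0) (at 0) \<and>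
      (\<forall>r. Zv (r * c, r * s) = r * B r)"
    by (rule normal_form_derivatives[OF nf]) (rule that)
  define c where "c = cos \<theta>"
  define s where "s = sin \<theta>"
  have c0: "c \<noteq> 0" and st: "s = t * c"
    using c by (simp_all add: c_def s_def t_def tan_def)
  obtain B where B: "B 0 = c * f331 0"
      "(B has_real_derivative c^2 * deriv f331 0 + 2 * c * s * f321 0 + 3 * s^2 * f322 0) (at 0)"
      "\<And>r. Zv (r * c, r * s) = r * B r"
    using ZvB[of c s] by blast
  define ray where "ray = (\<lambda>r::real. (r * c, r * s))"
  have bd: "blow_down (r, \<theta>) = ray r" for r
    by (simp add: blow_down_def ray_def c_def s_def)
  have ray0: "ray 0 = 0" by (simp add: ray_def zero_prod_def)
  have DR: "((\<lambda>r. G (ray r)) has_real_derivative c * \<alpha> + s * \<beta>) (at 0)" if "has_gradient G \<alpha> \<beta> 0" for G \<alpha> \<beta>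
    using has_gradient_ray[of G \<alpha> \<beta> 0 c s] that by (simp add: ray_def zero_prod_def)
  have nearV: "\<forall>\<^sub>F r in at 0. ray r \<in> V"
  proof -
    have "isCont ray 0" unfolding ray_def by (intro continuous_intros)
    then have "(ray \<longlongrightarrow> 0) (at 0)" by (simp add: isCont_def ray0)
    then show ?thesis using V by (rule topological_tendstoD)
  qed
  have nearU: "\<forall>\<^sub>F r in at 0. (r, \<theta>) \<in> U"
  proof -
    have "((\<lambda>r. (r, \<theta>)) \<longlongrightarrow> (0, \<theta>)) (at 0)" by (intro tendsto_intros)
    then show ?thesis using U(1) p0 by (rule topological_tendstoD)
  qed
  have near: "\<forall>\<^sub>F r in at 0. ray r \<in> V \<and> (r, \<theta>) \<in> U \<and> r \<noteq> 0"
    using nearV nearU eventually_neq_at_within[of "0::real" 0 UNIV] by eventually_elim simp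
  define x where "x r = \<nu> (r, \<theta>) $ 1" for r
  define y where "y r = \<nu> (r, \<theta>) $ 2" for r
  define z where "z r = \<nu> (r, \<theta>) $ 3" for r
  define k where "k r = \<kappa> (r, \<theta>)" for r
  define x1 where "x1 = pdu \<nu> (0, \<theta>) $ 1"
  define y1 where "y1 = pdu \<nu> (0, \<theta>) $ 2"
  define z1 where "z1 = pdu \<nu> (0, \<theta>) $ 3"
  have D\<nu>: "(x has_real_derivative x1) (at 0)" "(y has_real_derivative y1) (at 0)" "(z has_real_derivative z1) (at 0)"
    unfolding x_def[abs_def] y_def[abs_def] z_def[abs_def] x1_def y1_def z1_def by (intro DERIV_vec_nth_fst diff)+
  obtain k1 where D\<kappa>: "(k has_real_derivative k1) (at 0)"
  proof -
    have "((\<lambda>r. (r, \<theta>)) has_derivative (\<lambda>w. (w, 0))) (at 0)"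
      by (auto intro!: derivative_eq_intros)
    then have "k differentiable (at 0)"
      unfolding k_def[abs_def] using diff(2)
      by (auto simp: differentiable_def intro: has_derivative_compose)
    then show thesis using that by (auto simp: real_differentiable_def)
  qed
  have eqs: "x r + Yu (ray r) * y r + Zu (ray r) * z r = 0"
      "2 * s * y r + B r * z r = 0" "x r ^ 2 + y r ^ 2 + z r ^ 2 = 1"
      "(Yuu (ray r) * y r + Zuu (ray r) * z r - k r * (1 + Yu (ray r) ^ 2 + Zu (ray r) ^ 2)) *
        (2 * y r + Zvv (ray r) * z r - k r * (r^2 * (4 * s^2 + B r ^ 2)))
        - (Zuv (ray r) * z r - k r * (r * (2 * s * Yu (ray r) + B r * Zu (ray r))))^2 = 0"
    if r: "ray r \<in> V \<and> (r, \<theta>) \<in> U \<and> r \<noteq> 0" for r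
  proof -
    have un: "unit_normal_at f (ray r) (\<nu> (r, \<theta>))" and pc: "principal_curvature_at f (ray r) (\<nu> (r, \<theta>)) (k r)"
      using normal[of "(r, \<theta>)"] r by (auto simp: bd k_def)
    have V: "ray r \<in> V" using r by simp
    have Zv: "Zv (ray r) = r * B r" and sn: "snd (ray r) = r * s" by (simp_all add: ray_def B(3))
    have "pdu f (ray r) \<bullet> \<nu> (r, \<theta>) = 0" "pdv f (ray r) \<bullet> \<nu> (r, \<theta>) = 0"
      using un by (simp_all add: unit_normal_at_def)
    then show "x r + Yu (ray r) * y r + Zu (ray r) * z r = 0"
      and "2 * s * y r + B r * z r = 0"
    proof -
      assume 1: "pdu f (ray r) \<bullet> \<nu> (r, \<theta>) = 0" and 2: "pdv f (ray r) \<bullet> \<nu> (r, \<theta>) = 0"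
      from 1 show "x r + Yu (ray r) * y r + Zu (ray r) * z r = 0"
        by (simp add: f1[OF V] inner_vec_def sum_3 x_def y_def z_def)
      \<comment> \<open>Orthogonality to f_v is divided by r here, off the exceptional fibre, before
        passing to the limit.\<close>
      from 2 have "r * (2 * s * y r + B r * z r) = 0"
        by (simp add: f1[OF V] inner_vec_def sum_3 Zv sn x_def y_def z_def algebra_simps)
      then show "2 * s * y r + B r * z r = 0" using r by simp
    qed
    have "\<nu> (r, \<theta>) \<bullet> \<nu> (r, \<theta>) = 1"
      using un by (simp add: unit_normal_at_def norm_eq_1)
    then show "x r ^ 2 + y r ^ 2 + z r ^ 2 = 1"
      by (simp add: inner_vec_def sum_3 x_def y_def z_def power2_eq_square)
    have "Determinants.det (second_form f (ray r) (\<nu> (r, \<theta>)) - k r *\<^sub>R first_form f (ray r)) = 0"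
      using pc by (simp add: principal_curvature_at_def)
    then show "(Yuu (ray r) * y r + Zuu (ray r) * z r - k r * (1 + Yu (ray r) ^ 2 + Zu (ray r) ^ 2)) *
        (2 * y r + Zvv (ray r) * z r - k r * (r^2 * (4 * s^2 + B r ^ 2)))
        - (Zuv (ray r) * z r - k r * (r * (2 * s * Yu (ray r) + B r * Zu (ray r))))^2 = 0"
      unfolding Determinants.det_2 second_form_def first_form_def f1[OF V] f2[OF V] Zv sn
      by (simp add: inner_vec_def sum_3 x_def[symmetric] y_def[symmetric] z_def[symmetric])
        (simp add: algebra_simps power2_eq_square)
  qed
  have ev: "\<forall>\<^sub>F r in at 0. x r + Yu (ray r) * y r + Zu (ray r) * z r = 0"
      "\<forall>\<^sub>F r in at 0. 2 * s * y r + B r * z r = 0"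
      "\<forall>\<^sub>F r in at 0. x r ^ 2 + y r ^ 2 + z r ^ 2 = 1"
      "\<forall>\<^sub>F r in at 0. (Yuu (ray r) * y r + Zuu (ray r) * z r - k r * (1 + Yu (ray r) ^ 2 + Zu (ray r) ^ 2)) *
        (2 * y r + Zvv (ray r) * z r - k r * (r^2 * (4 * s^2 + B r ^ 2)))
        - (Zuv (ray r) * z r - k r * (r * (2 * s * Yu (ray r) + B r * Zu (ray r))))^2 = 0"
    using eqs by (blast intro: eventually_mono[OF near])+
  have v0: "Yu (ray 0) = 0" "Zu (ray 0) = 0" "Zvv (ray 0) = 0"
    by (simp_all add: ray0 val)
  note sol = first_order_equations[OF D\<nu> D\<kappa> DR[OF grad(1)] DR[OF grad(2)] B(2) DR[OF grad(3)] DR[OF grad(4)]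
      DR[OF grad(5)] DR[OF grad(6)] v0 ev, unfolded ray0 val B(1)]
  have x0: "x 0 = 0" by (fact sol(1))
  have fin: "k 0 * y 0 = - a * \<rho>" "k 0 * z 0 = 2 * t * \<rho>" "c + k 0 * x1 = c * (1 - 4 * Q^2 / \<Delta>)"
    "- a * \<rho>' * (k1 * z 0 + k 0 * z1) - (2 * \<rho> + 2 * t * \<rho>') * (k1 * y 0 + k 0 * y1)
      = 24 * a * c * Q * S / \<Delta>^2"
    unfolding \<rho>_def \<rho>'_def Q_def S_def \<Delta>_def
    by (rule first_order_solution[OF a c0 st, where ?y0.0 = "y 0" and ?z0.0 = "z 0" and ?x1.0 = x1
          and ?y1.0 = y1 and ?z1.0 = z1 and ?k0.0 = "k 0" and ?k1.0 = k1
          and ?b20.0 = "f21 0" and ?b21.0 = "deriv f21 0" and ?b30.0 = "f31 0" and ?b31.0 = "deriv f31 0"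
          and ?a1.0 = "deriv f331 0" and d = "f321 0" and g = "f322 0"];
        use sol in \<open>simp add: a_def algebra_simps\<close>)+
  have h0: "h (abs_blowup (0, \<theta>)) = \<kappa> (0, \<theta>) *\<^sub>R \<nu> (0, \<theta>)"
    using h[OF p0] f[OF V(2)] by (simp add: bd ray0 YZ Finite_Cartesian_Product.vec_eq_iff forall_3)
  show "exceptional_curve h \<theta> = vector [0, - a * \<rho>, 2 * t * \<rho>]"
    using fin(1,2) x0 by (simp add: exceptional_curve_def h0 Finite_Cartesian_Product.vec_eq_iff forall_3 x_def y_def z_def k_def)
  have bdd: "blow_down differentiable (at (0, \<theta>))"
  proof -
    have "(blow_down has_derivative (\<lambda>w. (fst w * cos \<theta>, fst w * sin \<theta>))) (at (0, \<theta>))"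
      unfolding blow_down_def split_beta by (auto intro!: derivative_eq_intros)
    then show ?thesis by (auto simp: differentiable_def)
  qed
  have "f differentiable (at (blow_down (0, \<theta>)))"
    using fd[OF V(2)] by (simp add: bd ray0)
  then have "(\<lambda>p. f (blow_down p)) differentiable (at (0, \<theta>))"
    using differentiable_chain_at[OF bdd] by (simp add: o_def)
  then have "(\<lambda>p. f (blow_down p) + \<kappa> p *\<^sub>R \<nu> p) differentiable (at (0, \<theta>))"
    using diff by (intro differentiable_add differentiable_scaleR)
  then obtain H' where "((\<lambda>p. f (blow_down p) + \<kappa> p *\<^sub>R \<nu> p) has_derivative H') (at (0, \<theta>))"
    by (auto simp: differentiable_def)
  then have "((\<lambda>p. h (abs_blowup p)) has_derivative H') (at (0, \<theta>))"
    by (rule has_derivative_transform_within_open[OF _ U(1) p0]) (simp add: h)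
  then show Hd: "(\<lambda>p. h (abs_blowup p)) differentiable (at (0, \<theta>))"
    by (auto simp: differentiable_def)
  let ?H = "pdu (\<lambda>p. h (abs_blowup p)) (0, \<theta>)"
  have comp: "?H $ i = \<phi>' + (k1 * \<nu> (0, \<theta>) $ i + k 0 * pdu \<nu> (0, \<theta>) $ i)"
    if \<phi>: "(\<phi> has_real_derivative \<phi>') (at 0)" "\<And>r. ray r \<in> V \<Longrightarrow> f (ray r) $ i = \<phi> r" for i \<phi> \<phi>'
  proof -
    have "((\<lambda>r. \<phi> r + k r * \<nu> (r, \<theta>) $ i) has_real_derivative
        \<phi>' + (k1 * \<nu> (0, \<theta>) $ i + k 0 * pdu \<nu> (0, \<theta>) $ i)) (at 0)"
      by (rule derivative_eq_intros \<phi>(1) D\<kappa> DERIV_vec_nth_fst[OF diff(1)] refl)+ simp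
    moreover have "((\<lambda>r. \<phi> r + k r * \<nu> (r, \<theta>) $ i) has_real_derivative ?H $ i) (at 0)"
    proof -
      have ev: "\<forall>\<^sub>F r in nhds 0. h (abs_blowup (r, \<theta>)) $ i = \<phi> r + k r * \<nu> (r, \<theta>) $ i"
      proof -
        have "\<forall>\<^sub>F r in nhds 0. ray r \<in> V \<and> (r, \<theta>) \<in> U"
          \<comment> \<open>The two facts concern punctured neighbourhoods; the point r = 0 is added
            because equality at it is needed to transfer a derivative.\<close>
          using nearV nearU V(2) p0 by (simp add: eventually_nhds_conv_at ray0 eventually_conj_iff)
        then show ?thesis
          by eventually_elim (simp add: h bd \<phi>(2) k_def)
      qed
      show ?thesis
        using DERIV_vec_nth_fst[OF Hd, of i] by (subst (asm) DERIV_cong_ev[OF refl ev refl])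
    qed
    ultimately show ?thesis by (rule DERIV_unique[symmetric])
  qed
  have "((\<lambda>r. r * c) has_real_derivative c) (at 0)" by (auto intro!: derivative_eq_intros)
  \<comment> \<open>Along the ray f is (r c, Y, Z) where Y and Z have zero gradient at the origin,
    so f contributes only c, in the first component.\<close>
  then have H1: "?H $ 1 = c * (1 - 4 * Q^2 / \<Delta>)"
    using comp[of "\<lambda>r. r * c" c 1] x0 fin(3) by (simp add: f ray_def x_def x1_def)
  have H2: "?H $ 2 = k1 * y 0 + k 0 * y1"
    using comp[of "\<lambda>r. Y (ray r)" "c * 0 + s * 0" 2] DR[OF YZ(1)] by (simp add: f y_def y1_def)
  have H3: "?H $ 3 = k1 * z 0 + k 0 * z1"
    using comp[of "\<lambda>r. Z (ray r)" "c * 0 + s * 0" 3] DR[OF YZ(2)] by (simp add: f z_def z1_def)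
  show "\<exists>Hy Hz. ?H = vector [cos \<theta> * (1 - 4 * Q^2 / \<Delta>), Hy, Hz] \<and>
      - a * \<rho>' * Hz - (2 * \<rho> + 2 * t * \<rho>') * Hy = 24 * a * cos \<theta> * Q * S / \<Delta>^2"
    using fin(4) H1 H2 H3
    by (intro exI[of _ "k1 * y 0 + k 0 * y1"] exI[of _ "k1 * z 0 + k 0 * z1"])
      (simp add: Finite_Cartesian_Product.vec_eq_iff forall_3 c_def)
qed

section \<open>Curvatures of the exceptional curve\<close>

text \<open>The surface is tangent to (0, p, q) and (A, Hy, Hz). Orthogonality to the first gives
  (ny, nz) = l (- q, p); the second then says nx A + l B = 0. As (A, B) and (nx, l) are both
  nonzero, (nx, l) is proportional to (B, - A), which locates the zeros of nx and of l. Pairing (ny,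
  nz) with (v, w) gives l times the determinant of (p, q) and (v, w).\<close>

lemma normal_vector_zeros:
  fixes p q :: real
  assumes pq: "p \<noteq> 0 \<or> q \<noteq> 0" and unit: "nx^2 + ny^2 + nz^2 = 1"
    and orth: "ny * p + nz * q = 0" "nx * A + ny * Hy + nz * Hz = 0"
    and B: "p * Hz - q * Hy = B" and AB: "\<not> (A = 0 \<and> B = 0)"
  shows "nx = 0 \<longleftrightarrow> B = 0" "ny * v + nz * w = 0 \<longleftrightarrow> p * w - q * v = 0 \<or> A = 0"
proof -
  define l where "l = (p * nz - q * ny) / (p^2 + q^2)"
  have pq2: "p^2 + q^2 \<noteq> 0" using pq by (simp add: sum_power2_eq_zero_iff)
  have "ny * (p^2 + q^2) = p * (ny * p + nz * q) - q * (p * nz - q * ny)"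
    "nz * (p^2 + q^2) = q * (ny * p + nz * q) + p * (p * nz - q * ny)"
    by (simp_all add: algebra_simps power2_eq_square)
  then have "ny * (p^2 + q^2) = - q * (p * nz - q * ny)" "nz * (p^2 + q^2) = p * (p * nz - q * ny)"
    unfolding orth(1) by simp_all
  then have n: "ny = - q * l" "nz = p * l"
    using pq2 by (simp_all add: l_def field_simps)
  have 1: "nx * A + l * B = 0" using orth(2) unfolding n B[symmetric] by (simp add: algebra_simps)
  have 2: "nx \<noteq> 0 \<or> l \<noteq> 0" using unit by (auto simp: n)
  show "nx = 0 \<longleftrightarrow> B = 0" using 1 2 AB by auto
  have "ny * v + nz * w = l * (p * w - q * v)" by (simp add: n algebra_simps)
  moreover have "l = 0 \<longleftrightarrow> A = 0" using 1 2 AB by auto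
  ultimately show "ny * v + nz * w = 0 \<longleftrightarrow> p * w - q * v = 0 \<or> A = 0" by auto
qed

text \<open>At r = 0 the sign change is invisible, so the relation only shifts \<theta> by multiples
  of \<pi>: a point is a line through the origin, and the tangent is its slope.\<close>

lemma abs_blowup_E0_eq_iff:
  assumes "cos \<theta> \<noteq> 0" "cos \<theta>' \<noteq> 0"
  shows "abs_blowup (0, \<theta>) = abs_blowup (0, \<theta>') \<longleftrightarrow> tan \<theta> = tan \<theta>'"
proof -
  have "abs_blowup (0, \<theta>) = abs_blowup (0, \<theta>') \<longleftrightarrow> (\<exists>k::int. \<theta>' = \<theta> + of_int k * pi)"
    by (simp add: blowup.abs_eq_iff blowup_rel_def)
  also have "\<dots> \<longleftrightarrow> sin (\<theta>' - \<theta>) = 0"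
    unfolding sin_zero_iff_int2 by (auto simp: algebra_simps)
  also have "\<dots> \<longleftrightarrow> tan \<theta> = tan \<theta>'"
    using assms by (auto simp: sin_diff tan_def field_simps)
  finally show ?thesis .
qed

text \<open>\<open>arctan\<close> picks one representative for each slope, giving a bijection from
  the real zeros in t.\<close>

lemma card_blowup_E0_zeros:
  assumes "\<And>\<theta>. cos \<theta> \<noteq> 0 \<Longrightarrow> Z \<theta> \<longleftrightarrow> z (tan \<theta>)"
  shows "card {abs_blowup (0, \<theta>) | \<theta>. cos \<theta> \<noteq> 0 \<and> Z \<theta>} = card {t. z t}"
proof -
  have "{abs_blowup (0, \<theta>) | \<theta>. cos \<theta> \<noteq> 0 \<and> Z \<theta>} = (\<lambda>t. abs_blowup (0, arctan t)) ` {t. z t}"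
  proof (intro equalityI subsetI)
    fix b assume "b \<in> {abs_blowup (0, \<theta>) | \<theta>. cos \<theta> \<noteq> 0 \<and> Z \<theta>}"
    then obtain \<theta> where "b = abs_blowup (0, \<theta>)" "cos \<theta> \<noteq> 0" "Z \<theta>" by blast
    then show "b \<in> (\<lambda>t. abs_blowup (0, arctan t)) ` {t. z t}"
      using assms abs_blowup_E0_eq_iff[of \<theta> "arctan (tan \<theta>)"]
      by (intro image_eqI[of _ _ "tan \<theta>"]) (simp_all add: tan_arctan)
  next
    fix b assume "b \<in> (\<lambda>t. abs_blowup (0, arctan t)) ` {t. z t}"
    then show "b \<in> {abs_blowup (0, \<theta>) | \<theta>. cos \<theta> \<noteq> 0 \<and> Z \<theta>}"
      using assms by (auto simp: tan_arctan)
  qed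
  moreover have "inj_on (\<lambda>t. abs_blowup (0, arctan t)) {t. z t}"
    by (rule inj_onI) (simp add: abs_blowup_E0_eq_iff tan_arctan)
  ultimately show ?thesis by (simp add: card_image)
qed

lemma has_vector_derivative_vector_3:
  assumes "(X has_real_derivative x') F" "(Y has_real_derivative y') F" "(Z has_real_derivative z') F"
  shows "((\<lambda>t. vector [X t, Y t, Z t] :: real^3) has_vector_derivative vector [x', y', z']) F"
  using has_derivative_vector_3[OF assms[unfolded has_field_derivative_def]]
  unfolding has_vector_derivative_def
  by (rule has_derivative_eq_rhs) (simp add: fun_eq_iff Finite_Cartesian_Product.vec_eq_iff forall_3)

text \<open>A curve on \<open>\<E>\<^sub>0\<close> is differentiated in the parameter \<open>t = tan \<theta>\<close>, where \<open>dt = (1 + t\<^sup>2) d\<theta>\<close>.\<close>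

lemma vector_derivative_tan:
  fixes e E :: "real \<Rightarrow> real^3"
  assumes e: "\<And>s. cos s \<noteq> 0 \<Longrightarrow> e s = E (tan s)"
    and E: "(E has_vector_derivative E') (at (tan \<theta>))" and \<theta>: "cos \<theta> \<noteq> 0"
  shows "(e has_vector_derivative (1 + tan \<theta> ^ 2) *\<^sub>R E') (at \<theta>)"
proof -
  have "(tan has_real_derivative inverse ((cos \<theta>)\<^sup>2)) (at \<theta>)"
    using DERIV_tan[OF \<theta>] .
  then have "(tan has_real_derivative 1 + tan \<theta> ^ 2) (at \<theta>)"
    using \<theta> by (simp add: tan_sec power_inverse)
  then have "(tan has_vector_derivative (1 + tan \<theta> ^ 2)) (at \<theta>)"
    by (simp add: has_real_derivative_iff_has_vector_derivative)
  from vector_diff_chain_at[OF this E]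
  have "((\<lambda>s. E (tan s)) has_vector_derivative (1 + tan \<theta> ^ 2) *\<^sub>R E') (at \<theta>)"
    by (simp add: o_def)
  moreover have "open {s::real. cos s \<noteq> 0}"
    by (intro open_Collect_neq continuous_intros)
  ultimately show ?thesis
    using \<theta> e by (rule_tac has_vector_derivative_transform_within_open[where S = "{s. cos s \<noteq> 0}"]) auto
qed

section \<open>The exceptional curve in the parameter t\<close>

locale E0_curve =
  fixes a b c :: real and e :: "real \<Rightarrow> real^3"
  assumes a: "a > 0"
    and e: "\<And>\<theta>. cos \<theta> \<noteq> 0 \<Longrightarrow> e \<theta> = (let t = tan \<theta>; \<rho> = 2 * (a * t^2 + 2 * c * t - a * b) / (a^2 + 4 * t^2)
      in vector [0, - a * \<rho>, 2 * t * \<rho>])"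
begin

definition "\<Delta> t = a^2 + 4 * t^2"
definition "Q t = a * t^2 + 2 * c * t - a * b"
definition "\<rho> t = 2 * Q t / \<Delta> t"
text \<open>\<open>\<rho>1\<close> and \<open>\<rho>2\<close> are the solutions of \<rho> \<Delta> =
  2 Q differentiated once and twice; the second derivative reads \<rho>2 \<Delta> + 16 t \<rho>1 + 8
  \<rho> = 4 a.\<close>

definition "\<rho>1 t = (2 * (2 * a * t + 2 * c) * \<Delta> t - 16 * t * Q t) / \<Delta> t ^ 2"
definition "\<rho>2 t = (4 * a - 8 * \<rho> t - 16 * t * \<rho>1 t) / \<Delta> t"
definition "E1 t = (vector [0, - a * \<rho>1 t, 2 * \<rho> t + 2 * t * \<rho>1 t] :: real^3)"
definition "E2 t = (vector [0, - a * \<rho>2 t, 4 * \<rho>1 t + 2 * t * \<rho>2 t] :: real^3)"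

lemma \<Delta>_pos: "\<Delta> t > 0"
  using a by (simp add: \<Delta>_def add_pos_nonneg)

lemma DERIV_\<rho>: "(\<rho> has_real_derivative \<rho>1 t) (at t)"
proof -
  have "\<rho> = (\<lambda>t. 2 * (a * t^2 + 2 * c * t - a * b) / (a^2 + 4 * t^2))"
    by (simp add: \<rho>_def[abs_def] Q_def \<Delta>_def)
  moreover have "((\<lambda>t. 2 * (a * t^2 + 2 * c * t - a * b) / (a^2 + 4 * t^2)) has_real_derivative \<rho>1 t) (at t)"
    using \<Delta>_pos[of t]
    by (auto intro!: derivative_eq_intros simp: \<rho>1_def \<Delta>_def Q_def power2_eq_square algebra_simps)
  ultimately show ?thesis by simp
qed

lemma DERIV_\<rho>1: "(\<rho>1 has_real_derivative \<rho>2 t) (at t)"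
proof -
  \<comment> \<open>Keeping \<rho> unexpanded leaves a single power of \<Delta> in the denominator
    and makes the next derivative short.\<close>
  have "\<rho>1 = (\<lambda>t. (2 * (2 * a * t + 2 * c) - 8 * t * \<rho> t) / (a^2 + 4 * t^2))"
  proof
    fix t
    show "\<rho>1 t = (2 * (2 * a * t + 2 * c) - 8 * t * \<rho> t) / (a^2 + 4 * t^2)"
      using \<Delta>_pos[of t] unfolding \<rho>1_def \<rho>_def \<Delta>_def[symmetric]
      by (simp add: field_simps power2_eq_square)
  qed
  moreover have "((\<lambda>t. (2 * (2 * a * t + 2 * c) - 8 * t * \<rho> t) / (a^2 + 4 * t^2)) has_real_derivative \<rho>2 t) (at t)"
  proof -
    have \<rho>1: "\<rho>1 t = (2 * (2 * a * t + 2 * c) - 8 * t * \<rho> t) / \<Delta> t"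
      using \<Delta>_pos[of t] unfolding \<rho>1_def \<rho>_def by (simp add: field_simps power2_eq_square)
    have "((\<lambda>t. (2 * (2 * a * t + 2 * c) - 8 * t * \<rho> t) / (a^2 + 4 * t^2)) has_real_derivative
      ((4 * a - 8 * (\<rho> t + t * \<rho>1 t)) * \<Delta> t - (2 * (2 * a * t + 2 * c) - 8 * t * \<rho> t) * (8 * t)) / (\<Delta> t * \<Delta> t)) (at t)"
      using \<Delta>_pos[of t] unfolding \<Delta>_def
      by (auto intro!: derivative_eq_intros DERIV_\<rho> simp: algebra_simps)
    also have "((4 * a - 8 * (\<rho> t + t * \<rho>1 t)) * \<Delta> t - (2 * (2 * a * t + 2 * c) - 8 * t * \<rho> t) * (8 * t)) / (\<Delta> t * \<Delta> t) = \<rho>2 t"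
    proof -
      have "2 * (2 * a * t + 2 * c) - 8 * t * \<rho> t = \<rho>1 t * \<Delta> t"
        using \<Delta>_pos[of t] by (simp add: \<rho>1)
      then show ?thesis using \<Delta>_pos[of t] by (simp add: \<rho>2_def field_simps)
    qed
    finally show ?thesis .
  qed
  ultimately show ?thesis by simp
qed

lemma curve_deriv:
  assumes "cos \<theta> \<noteq> 0"
  shows "vector_derivative e (at \<theta>) = (1 + tan \<theta> ^ 2) *\<^sub>R E1 (tan \<theta>)"
proof (rule vector_derivative_at, rule vector_derivative_tan[OF _ _ assms])
  show "e s = vector [0, - a * \<rho> (tan s), 2 * tan s * \<rho> (tan s)]" if "cos s \<noteq> 0" for s
    using e[OF that] by (simp add: Let_def \<rho>_def Q_def \<Delta>_def)
  show "((\<lambda>t. vector [0, - a * \<rho> t, 2 * t * \<rho> t] :: real^3) has_vector_derivative E1 (tan \<theta>)) (at (tan \<theta>))"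
    unfolding E1_def by (rule has_vector_derivative_vector_3) (auto intro!: derivative_eq_intros DERIV_\<rho>)
qed

lemma curve_deriv2:
  assumes "cos \<theta> \<noteq> 0"
  shows "vector_derivative (\<lambda>s. vector_derivative e (at s)) (at \<theta>)
    = (1 + tan \<theta> ^ 2) *\<^sub>R ((1 + tan \<theta> ^ 2) *\<^sub>R E2 (tan \<theta>) + (2 * tan \<theta>) *\<^sub>R E1 (tan \<theta>))"
proof (rule vector_derivative_at, rule vector_derivative_tan[OF _ _ assms])
  show "vector_derivative e (at s) = (1 + tan s ^ 2) *\<^sub>R E1 (tan s)" if "cos s \<noteq> 0" for s
    using curve_deriv[OF that] .
  have E1: "(E1 has_vector_derivative E2 t) (at t)" for t
    unfolding E1_def[abs_def] E2_def
    by (rule has_vector_derivative_vector_3) (auto intro!: derivative_eq_intros DERIV_\<rho> DERIV_\<rho>1)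
  have "((\<lambda>t. 1 + t^2) has_real_derivative 2 * t) (at t)" for t :: real
    by (auto intro!: derivative_eq_intros)
  from has_vector_derivative_scaleR[OF this E1]
  show "((\<lambda>t. (1 + t^2) *\<^sub>R E1 t) has_vector_derivative
      (1 + tan \<theta> ^ 2) *\<^sub>R E2 (tan \<theta>) + (2 * tan \<theta>) *\<^sub>R E1 (tan \<theta>)) (at (tan \<theta>))" .
qed

definition "W t = - (8 * c) * t^3 + (3 * a^3 + 12 * a * b) * t^2 + 6 * a^2 * c * t
  + (4 * a * b^2 + 4 * a * c^2 + a^3 * b)"

text \<open>In the normal plane E1 = \<rho>1 (- a, 2 t) + \<rho> (0, 2) and E2 = \<rho>2 (- a, 2 t)
  + 2 \<rho>1 (0, 2), so the determinant is - 2 a (2 \<rho>1^2 - \<rho> \<rho>2).\<close>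

lemma E1_cross_E2: "E1 t $ 2 * E2 t $ 3 - E1 t $ 3 * E2 t $ 2 = - 16 * a^2 * W t / \<Delta> t ^ 3"
proof -
  let ?q = "2 * a * t + 2 * c"
  have D: "\<Delta> t \<noteq> 0" using \<Delta>_pos[of t] by simp
  have r: "\<rho> t * \<Delta> t = 2 * Q t" "\<rho>1 t * \<Delta> t ^ 2 = 2 * ?q * \<Delta> t - 16 * t * Q t"
    "\<rho>2 t * \<Delta> t = 4 * a - 8 * \<rho> t - 16 * t * \<rho>1 t"
    using D by (simp_all add: \<rho>_def \<rho>1_def \<rho>2_def)
  have "\<rho>2 t * \<Delta> t ^ 3 = (\<rho>2 t * \<Delta> t) * \<Delta> t ^ 2"
    by (simp add: power2_eq_square power3_eq_cube)
  also have "\<dots> = 4 * a * \<Delta> t ^ 2 - 8 * (\<rho> t * \<Delta> t) * \<Delta> t - 16 * t * (\<rho>1 t * \<Delta> t ^ 2)"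
    unfolding r(3) by (simp add: algebra_simps power2_eq_square)
  finally have r2: "\<rho>2 t * \<Delta> t ^ 3 = 4 * a * \<Delta> t ^ 2 - 16 * Q t * \<Delta> t - 16 * t * (2 * ?q * \<Delta> t - 16 * t * Q t)"
    unfolding r(1,2) by simp
  \<comment> \<open>Clearing denominators takes \<Delta>^4, but the resulting polynomial contains a
    factor \<Delta>, so the cube remains; the cofactor is a multiple of \<open>W\<close>.\<close>
  have "(2 * \<rho>1 t ^ 2 - \<rho> t * \<rho>2 t) * \<Delta> t ^ 4
    = 2 * (\<rho>1 t * \<Delta> t ^ 2)^2 - (\<rho> t * \<Delta> t) * (\<rho>2 t * \<Delta> t ^ 3)"
    by (simp add: algebra_simps power2_eq_square power3_eq_cube power4_eq_xxxx)
  also have "\<dots> = 2 * (2 * ?q * \<Delta> t - 16 * t * Q t)^2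
      - 2 * Q t * (4 * a * \<Delta> t ^ 2 - 16 * Q t * \<Delta> t - 16 * t * (2 * ?q * \<Delta> t - 16 * t * Q t))"
    unfolding r(1,2) r2 ..
  also have "\<dots> = 4 * (8 * Q t ^ 2 - 16 * t * Q t * ?q - 2 * a * \<Delta> t * Q t + 2 * \<Delta> t * ?q^2) * \<Delta> t"
    by (simp add: algebra_simps power2_eq_square)
  also have "8 * Q t ^ 2 - 16 * t * Q t * ?q - 2 * a * \<Delta> t * Q t + 2 * \<Delta> t * ?q^2 = 2 * a * W t"
    by (simp add: \<Delta>_def Q_def W_def algebra_simps power2_eq_square power3_eq_cube)
  finally have "\<Delta> t * ((2 * \<rho>1 t ^ 2 - \<rho> t * \<rho>2 t) * \<Delta> t ^ 3) = \<Delta> t * (8 * a * W t)"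
    by (simp add: power4_eq_xxxx power3_eq_cube mult_ac)
  then have "(2 * \<rho>1 t ^ 2 - \<rho> t * \<rho>2 t) * \<Delta> t ^ 3 = 8 * a * W t"
    using D by simp
  then have "2 * \<rho>1 t ^ 2 - \<rho> t * \<rho>2 t = 8 * a * W t / \<Delta> t ^ 3"
    using D by (simp add: field_simps)
  moreover have "E1 t $ 2 * E2 t $ 3 - E1 t $ 3 * E2 t $ 2 = - 2 * a * (2 * \<rho>1 t ^ 2 - \<rho> t * \<rho>2 t)"
    by (simp add: E1_def E2_def algebra_simps power2_eq_square)
  ultimately show ?thesis by (simp add: power2_eq_square)
qed

text \<open>If E1 vanishes, its second component forces \<rho>1 = 0 and then the third \<rho> = 0,
  hence Q = 0; the determinant with E2 vanishes as well, hence W = 0.\<close>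

lemma E1_nonzero:
  assumes "\<not> (W t = 0 \<and> Q t = 0)"
  shows "E1 t $ 2 \<noteq> 0 \<or> E1 t $ 3 \<noteq> 0"
proof (rule ccontr)
  assume "\<not> ?thesis"
  then have 0: "E1 t $ 2 = 0" "E1 t $ 3 = 0" by auto
  then have "\<rho> t = 0" using a by (simp add: E1_def)
  then have "Q t = 0" using \<Delta>_pos[of t] by (simp add: \<rho>_def)
  moreover have "W t = 0" using E1_cross_E2[of t] 0 a \<Delta>_pos[of t] by simp
  ultimately show False using assms by simp
qed

text \<open>The acceleration is a multiple of E2 plus a multiple of E1, and the latter affects
  neither curvature. As E1 and E2 lie in the normal plane, the geodesic determinant is the first
  coordinate of n times det (E1, E2), and the normal curvature uses only the other two coordinates
  of n.\<close>

lemma curvature_zeros: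
  fixes n :: "real^3"
  assumes \<theta>: "cos \<theta> \<noteq> 0" and n: "n \<bullet> n = 1"
    and orth: "vector_derivative e (at \<theta>) \<bullet> n = 0" "vector [k * (1 - 4 * Q (tan \<theta>) ^ 2 / \<Delta> (tan \<theta>)), Hy, Hz] \<bullet> n = 0"
    and k: "k \<noteq> 0" and H: "E1 (tan \<theta>) $ 2 * Hz - E1 (tan \<theta>) $ 3 * Hy = 24 * a * k * Q (tan \<theta>) * s / \<Delta> (tan \<theta>) ^ 2"
    and generic: "\<not> (W (tan \<theta>) = 0 \<and> Q (tan \<theta>) = 0)" "\<not> (4 * Q (tan \<theta>) ^ 2 - \<Delta> (tan \<theta>) = 0 \<and> Q (tan \<theta>) * s = 0)"
  shows "geodesic_curvature e n \<theta> = 0 \<longleftrightarrow> W (tan \<theta>) * (Q (tan \<theta>) * s) = 0"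
    "normal_curvature e n \<theta> = 0 \<longleftrightarrow> W (tan \<theta>) * (4 * Q (tan \<theta>) ^ 2 - \<Delta> (tan \<theta>)) = 0"
    "vector_derivative e (at \<theta>) \<noteq> 0"
proof -
  define t where "t = tan \<theta>"
  note D = \<Delta>_pos[of t]
  define m where "m = 1 + t^2"
  have m: "m > 0" by (simp add: m_def add_pos_nonneg)
  have e1: "vector_derivative e (at \<theta>) = m *\<^sub>R E1 t"
    using curve_deriv[OF \<theta>] by (simp add: t_def m_def)
  have e2: "vector_derivative (\<lambda>s. vector_derivative e (at s)) (at \<theta>) = m *\<^sub>R (m *\<^sub>R E2 t + (2 * t) *\<^sub>R E1 t)"
    using curve_deriv2[OF \<theta>] by (simp add: t_def m_def)
  have E0: "E1 t $ 1 = 0" "E2 t $ 1 = 0" by (simp_all add: E1_def E2_def)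
  have pq: "E1 t $ 2 \<noteq> 0 \<or> E1 t $ 3 \<noteq> 0"
    using E1_nonzero generic(1) by (simp add: t_def)
  then have "E1 t \<noteq> 0" by auto
  then show ne: "vector_derivative e (at \<theta>) \<noteq> 0"
    using m by (simp add: e1)
  have E1n: "E1 t \<bullet> n = 0" using orth(1) m by (simp add: e1)
  \<comment> \<open>\<open>?A\<close> is the first component of \<partial>h/\<partial>r, a multiple
    of 1 - \<open>\<kappa>\<^sub>1^2\<close>; \<open>?B\<close> is the plane determinant of E1 and
    \<partial>h/\<partial>r.\<close>
  let ?A = "k * (1 - 4 * Q t ^ 2 / \<Delta> t)" and ?B = "24 * a * k * Q t * s / \<Delta> t ^ 2"
  have A0: "?A = 0 \<longleftrightarrow> 4 * Q t ^ 2 - \<Delta> t = 0" using k D by (auto simp: field_simps)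
  have B0: "?B = 0 \<longleftrightarrow> Q t * s = 0" using k D a by auto
  have C0: "E1 t $ 2 * E2 t $ 3 - E1 t $ 3 * E2 t $ 2 = 0 \<longleftrightarrow> W t = 0"
    using a D by (simp add: E1_cross_E2)
  have un: "(n $ 1)^2 + (n $ 2)^2 + (n $ 3)^2 = 1"
    using n by (simp add: inner_vec_def sum_3 power2_eq_square)
  have o1: "n $ 2 * E1 t $ 2 + n $ 3 * E1 t $ 3 = 0"
    using E1n by (simp add: inner_vec_def sum_3 E0 algebra_simps)
  have o2: "n $ 1 * ?A + n $ 2 * Hy + n $ 3 * Hz = 0"
    using orth(2) by (simp add: inner_vec_def sum_3 t_def algebra_simps)
  have "\<not> (?A = 0 \<and> ?B = 0)" using generic(2)[folded t_def] A0 B0 by blast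
  note nz = normal_vector_zeros[OF pq un o1 o2 H[folded t_def] this, unfolded A0 B0]
  have "Determinants.det (vector [m *\<^sub>R E1 t, m *\<^sub>R (m *\<^sub>R E2 t + (2 * t) *\<^sub>R E1 t), n] :: real^3^3)
      = m^3 * (n $ 1 * (E1 t $ 2 * E2 t $ 3 - E1 t $ 3 * E2 t $ 2))"
    by (simp add: Determinants.det_3 E0) (simp add: algebra_simps power3_eq_cube)
  then have "geodesic_curvature e n \<theta> = 0 \<longleftrightarrow> n $ 1 = 0 \<or> W t = 0"
    using ne m C0 unfolding geodesic_curvature_def e2 by (simp add: e1)
  then show "geodesic_curvature e n \<theta> = 0 \<longleftrightarrow> W (tan \<theta>) * (Q (tan \<theta>) * s) = 0"
    using nz(1) by (auto simp: t_def)
  have "(m *\<^sub>R (m *\<^sub>R E2 t + (2 * t) *\<^sub>R E1 t)) \<bullet> n = m^2 * (n $ 2 * E2 t $ 2 + n $ 3 * E2 t $ 3)"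
    by (simp add: inner_add_left E1n) (simp add: inner_vec_def sum_3 E0 algebra_simps power2_eq_square)
  then have "normal_curvature e n \<theta> = 0 \<longleftrightarrow> n $ 2 * E2 t $ 2 + n $ 3 * E2 t $ 3 = 0"
    using ne m unfolding normal_curvature_def e2 by (simp add: e1)
  also have "\<dots> \<longleftrightarrow> W t = 0 \<or> 4 * Q t ^ 2 - \<Delta> t = 0" using nz(2) C0 by blast
  finally show "normal_curvature e n \<theta> = 0 \<longleftrightarrow> W (tan \<theta>) * (4 * Q (tan \<theta>) ^ 2 - \<Delta> (tan \<theta>)) = 0"
    by (simp add: t_def)
qed

end

section \<open>Generic umbrellas\<close>

lemma poly_jets:
  fixes x :: jet_space
  assumes "x = (jet2 f21, jet2 f31, jet1 f321, jet1_two_var f322, jet2 f331)"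
  defines "a \<equiv> f331 0" and "b \<equiv> f21 0" and "c \<equiv> f31 0"
  shows "poly (pedal_poly x) t = a * t^2 + 2 * c * t - a * b"
    "poly (inflection_poly x) t = - (8 * c) * t^3 + (3 * a^3 + 12 * a * b) * t^2 + 6 * a^2 * c * t
      + (4 * a * b^2 + 4 * a * c^2 + a^3 * b)"
    "poly (transversality_poly x) t = 2 * f322 0 * t^4 + 2 * f321 0 * t^3 + 2 * deriv f331 0 * t^2
      + 2 * deriv f31 0 * t - a * deriv f21 0"
    "poly (unit_curvature_poly x) t = 4 * (a * t^2 + 2 * c * t - a * b)^2 - (a^2 + 4 * t^2)"
  by (simp_all add: assms pedal_poly_def inflection_poly_def transversality_poly_def unit_curvature_poly_def
      Let_def jet1_def jet2_def jet1_two_var_def algebra_simps power2_eq_square power3_eq_cube power4_eq_xxxx)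

lemma generic_principal_curvature_surface:
  assumes nf: "normal_form f f21 f31 f321 f322 f331"
    and x: "x = (jet2 f21, jet2 f31, jet1 f321, jet1_two_var f322, jet2 f331)"
    and pcs: "principal_curvature_surface f h"
    and gen: "coprime (total_poly x) (pderiv (total_poly x))"
  shows "curve_singular_set h = {}"
    "unit_normal_along_E0 h n \<Longrightarrow> card (geodesic_zeros h n)
      = card {t. poly (inflection_poly x * (pedal_poly x * transversality_poly x)) t = 0}"
    "unit_normal_along_E0 h n \<Longrightarrow> card (normal_zeros h n)
      = card {t. poly (inflection_poly x * unit_curvature_poly x) t = 0}"
proof -
  let ?e = "exceptional_curve h"
  let ?S = "\<lambda>t. poly (transversality_poly x) t"
  have a: "f331 0 > 0" using nf by (simp add: normal_form_def)
  note along = principal_curvature_surface_along_E0[OF nf pcs]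
  interpret E0_curve "f331 0" "f21 0" "f31 0" ?e
    by standard (simp_all add: a along(1) Let_def)
  have poly: "poly (pedal_poly x) t = Q t" "poly (inflection_poly x) t = W t"
    "poly (unit_curvature_poly x) t = 4 * Q t ^ 2 - \<Delta> t" for t
    using poly_jets(1,2,4)[OF x] by (simp_all add: Q_def W_def \<Delta>_def)
  \<comment> \<open>Two groupings of the same square-free product: the first gives regularity of the
    curve, the second keeps the two tangent quantities from vanishing together.\<close>
  have "coprime (inflection_poly x) (pedal_poly x)"
    "coprime (pedal_poly x * transversality_poly x) (unit_curvature_poly x)"
    using coprime_pderiv_factor(2)[of "inflection_poly x" "pedal_poly x * transversality_poly x * unit_curvature_poly x"]
      coprime_pderiv_factor(2)[of "inflection_poly x * (pedal_poly x * transversality_poly x)" "unit_curvature_poly x"] gen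
    by (simp_all add: total_poly_def mult.assoc)
  from this[THEN coprime_no_common_root]
  have generic: "\<not> (W t = 0 \<and> Q t = 0)" "\<not> (4 * Q t ^ 2 - \<Delta> t = 0 \<and> Q t * ?S t = 0)" for t
    by (auto simp: poly)
  have "(1 + tan \<theta> ^ 2) *\<^sub>R E1 (tan \<theta>) \<noteq> 0" for \<theta>
  proof -
    have "1 + tan \<theta> ^ 2 > 0" by (simp add: add_pos_nonneg)
    moreover have "E1 (tan \<theta>) \<noteq> 0" using E1_nonzero[OF generic(1), of "tan \<theta>"] by auto
    ultimately show ?thesis by simp
  qed
  then have regular: "vector_derivative ?e (at \<theta>) \<noteq> 0" if "cos \<theta> \<noteq> 0" for \<theta>
    using curve_deriv[OF that] by simp
  then show sing: "curve_singular_set h = {}"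
    by (auto simp: curve_singular_set_def)
  have zeros: "geodesic_curvature ?e (n (abs_blowup (0, \<theta>))) \<theta> = 0
      \<longleftrightarrow> poly (inflection_poly x * (pedal_poly x * transversality_poly x)) (tan \<theta>) = 0"
    "normal_curvature ?e (n (abs_blowup (0, \<theta>))) \<theta> = 0
      \<longleftrightarrow> poly (inflection_poly x * unit_curvature_poly x) (tan \<theta>) = 0"
    if n: "unit_normal_along_E0 h n" and \<theta>: "cos \<theta> \<noteq> 0" for \<theta>
  proof -
    let ?N = "n (abs_blowup (0, \<theta>))" and ?H = "\<lambda>p. h (abs_blowup p)"
    have un: "unit_normal_at ?H (0, \<theta>) ?N"
      using n \<theta> by (simp add: unit_normal_along_E0_def)
    then have N: "?N \<bullet> ?N = 1" "pdu ?H (0, \<theta>) \<bullet> ?N = 0" "pdv ?H (0, \<theta>) \<bullet> ?N = 0"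
      by (simp_all add: unit_normal_at_def norm_eq_1)
    have "(?e has_vector_derivative pdv ?H (0, \<theta>)) (at \<theta>)"
      using has_vector_derivative_snd[OF along(2)[OF \<theta>]] by (simp add: exceptional_curve_def[abs_def])
    then have e: "vector_derivative ?e (at \<theta>) \<bullet> ?N = 0"
      using N(3) by (simp add: vector_derivative_at)
    obtain Hy Hz where H: "pdu ?H (0, \<theta>) = vector [cos \<theta> * (1 - 4 * Q (tan \<theta>) ^ 2 / \<Delta> (tan \<theta>)), Hy, Hz]"
      "E1 (tan \<theta>) $ 2 * Hz - E1 (tan \<theta>) $ 3 * Hy = 24 * f331 0 * cos \<theta> * Q (tan \<theta>) * ?S (tan \<theta>) / \<Delta> (tan \<theta>) ^ 2"
      using along(3)[OF \<theta>] unfolding poly_jets(3)[OF x] E1_def \<rho>_def \<rho>1_def Q_def \<Delta>_def vector_3 by blast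
    from curvature_zeros[OF \<theta> N(1) e N(2)[unfolded H(1)] \<theta> H(2) generic]
    show "geodesic_curvature ?e ?N \<theta> = 0
      \<longleftrightarrow> poly (inflection_poly x * (pedal_poly x * transversality_poly x)) (tan \<theta>) = 0"
      "normal_curvature ?e ?N \<theta> = 0 \<longleftrightarrow> poly (inflection_poly x * unit_curvature_poly x) (tan \<theta>) = 0"
      by (simp_all add: poly)
  qed
  show "card (geodesic_zeros h n)
      = card {t. poly (inflection_poly x * (pedal_poly x * transversality_poly x)) t = 0}"
    if "unit_normal_along_E0 h n"
    unfolding geodesic_zeros_def sing Diff_empty by (rule card_blowup_E0_zeros) (rule zeros(1)[OF that])
  show "card (normal_zeros h n) = card {t. poly (inflection_poly x * unit_curvature_poly x) t = 0}"
    if "unit_normal_along_E0 h n"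
    unfolding normal_zeros_def sing Diff_empty by (rule card_blowup_E0_zeros) (rule zeros(2)[OF that])
qed

lemma odd_bounded_eq:
  fixes N :: nat
  assumes "odd N" "N \<le> 2 * k - 1"
  shows "\<exists>m\<in>{1..k}. N = 2 * m - 1"
proof -
  obtain j where "N = 2 * j + 1" using assms(1) by (rule oddE)
  with assms(2) show ?thesis by (intro bexI[of _ "j + 1"]) auto
qed

text \<open>The bounds are the degrees 3 + 2 + 4 = 9 = 2 * 5 - 1 and 3 + 4 = 7 = 2 * 4 - 1, both
  odd; square-freeness passes from \<open>total_poly\<close> to these partial products.\<close>

lemma card_generic_roots:
  assumes x: "x \<in> umbrella_jets" "fst (snd x) $ 1 \<noteq> 0" "fst (snd (snd (snd x))) $ 1 \<noteq> 0"
    and gen: "coprime (total_poly x) (pderiv (total_poly x))"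
  shows "\<exists>m\<in>{1..5}. card {t. poly (inflection_poly x * (pedal_poly x * transversality_poly x)) t = 0} = 2 * m - 1"
    "\<exists>m\<in>{1..4}. card {t. poly (inflection_poly x * unit_curvature_poly x) t = 0} = 2 * m - 1"
proof -
  let ?g = "inflection_poly x * (pedal_poly x * transversality_poly x)"
  let ?k = "inflection_poly x * unit_curvature_poly x"
  note deg = degree_geodesic_poly[OF x] degree_unit_curvature_poly[OF x(1)]
  have "inflection_poly x \<noteq> 0" "pedal_poly x \<noteq> 0" "transversality_poly x \<noteq> 0" "unit_curvature_poly x \<noteq> 0"
    using deg by fastforce+
  then have dg: "degree ?g = 9" "degree ?k = 7"
    using deg by (simp_all add: degree_mult_eq)
  have "total_poly x = ?g * unit_curvature_poly x" "total_poly x = ?k * (pedal_poly x * transversality_poly x)"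
    by (simp_all add: total_poly_def mult_ac)
  then have "coprime ?g (pderiv ?g)" "coprime ?k (pderiv ?k)"
    using gen coprime_pderiv_factor(1) by metis+
  then have "odd (card {t. poly ?g t = 0})" "card {t. poly ?g t = 0} \<le> 9"
    "odd (card {t. poly ?k t = 0})" "card {t. poly ?k t = 0} \<le> 7"
    using odd_card_real_roots[of ?g] odd_card_real_roots[of ?k] dg by simp_all
  then show "\<exists>m\<in>{1..5}. card {t. poly ?g t = 0} = 2 * m - 1" "\<exists>m\<in>{1..4}. card {t. poly ?k t = 0} = 2 * m - 1"
    using odd_bounded_eq[of _ 5] odd_bounded_eq[of _ 4] by simp_all
qed

theorem theorem5p2:
  "(\<exists>A. algebraic_subset A \<and> A \<subset> umbrella_jets \<and>
      (\<forall>f h. umbrella_in f (umbrella_jets - A) \<and> principal_curvature_surface f h \<longrightarrow>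
         curve_singular_set h = {} \<and>
         (\<forall>n. unit_normal_along_E0 h n \<longrightarrow>
            (\<exists>m\<in>{1..5}. card (geodesic_zeros h n) = 2 * m - 1)))) \<and>
   (\<exists>A. algebraic_subset A \<and> A \<subset> umbrella_jets \<and>
      (\<forall>f h. umbrella_in f (umbrella_jets - A) \<and> principal_curvature_surface f h \<longrightarrow>
         curve_singular_set h = {} \<and>
         (\<forall>n. unit_normal_along_E0 h n \<longrightarrow>
            (\<exists>m\<in>{1..4}. card (normal_zeros h n) = 2 * m - 1))))"
proof -
  \<comment> \<open>The same exceptional set is taken for both curvatures.\<close>
  define A where "A = {x \<in> umbrella_jets. genericity x = 0}"
  have alg: "algebraic_subset A"
    unfolding algebraic_subset_def A_def
    by (intro exI[of _ "{genericity}"]) (simp add: real_polynomial_function_genericity)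
  have proper: "A \<subset> umbrella_jets"
    using generic_jet by (auto simp: A_def)
  have main: "curve_singular_set h = {}"
    "unit_normal_along_E0 h n \<Longrightarrow> \<exists>m\<in>{1..5}. card (geodesic_zeros h n) = 2 * m - 1"
    "unit_normal_along_E0 h n \<Longrightarrow> \<exists>m\<in>{1..4}. card (normal_zeros h n) = 2 * m - 1"
    if f: "umbrella_in f (umbrella_jets - A)" and h: "principal_curvature_surface f h" for f h n
  proof -
    obtain f21 f31 f321 f322 f331 x where nf: "normal_form f f21 f31 f321 f322 f331"
      and x: "x = (jet2 f21, jet2 f31, jet1 f321, jet1_two_var f322, jet2 f331)"
      and "x \<in> umbrella_jets - A"
      using f unfolding umbrella_in_def by blast
    then have X: "x \<in> umbrella_jets" "genericity x \<noteq> 0" by (auto simp: A_def)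
    then have lead: "fst (snd x) $ 1 \<noteq> 0" "fst (snd (snd (snd x))) $ 1 \<noteq> 0"
      by (auto simp: genericity_def)
    have gen: "coprime (total_poly x) (pderiv (total_poly x))"
      using coprime_total_poly_iff[OF X(1) lead] X(2) by simp
    note surface = generic_principal_curvature_surface[OF nf x h gen]
    note roots = card_generic_roots[OF X(1) lead gen]
    show "curve_singular_set h = {}" by (fact surface(1))
    show "\<exists>m\<in>{1..5}. card (geodesic_zeros h n) = 2 * m - 1"
      "\<exists>m\<in>{1..4}. card (normal_zeros h n) = 2 * m - 1" if "unit_normal_along_E0 h n"
      using surface(2,3)[OF that] roots by simp_all
  qed
  show ?thesis
    using alg proper main by (intro conjI exI[of _ A]) auto
qed

end
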